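(* Let $G$ be a finitely generated periodic group of orientation preserving homeomorphisms of the $2$-sphere $\mathbb{S}^2$. If $G$ has a finite orbit in $\mathbb{S}^2$ of cardinality at least $3$, then $G$ is finite.
   Context: A group $G$ is periodic if every $g\in G$ has finite order, i.e. there is a positive integer $n$ with $g^n=\mathrm{id}$. The orbit of $x\in\mathbb{S}^2$ is $\{g(x): g\in G\}$. A group of homeomorphisms of $\mathbb{S}^2$ is a subgroup of the group of all homeomorphisms of $\mathbb{S}^2$. *)

theory Defs
  imports "HOL-Homology.Homology" "HOL-Algebra.Bij" "HOL-Algebra.Generated_Groups" "HOL-Algebra.Group_Action"
begin

text \<open>
  The group of all self-homeomorphisms of a topological space. As in \<^const>\<open>BijGroup\<close>, its
  elements are functions extensional on the space, so that equality of elements is equality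
  of maps on the space.
\<close>

definition Homeo :: "'a topology \<Rightarrow> ('a \<Rightarrow> 'a) monoid" where
  "Homeo X = BijGroup (topspace X) \<lparr>carrier := {f \<in> Bij (topspace X). homeomorphic_map X X f}\<rparr>"

lemma subgroup_Homeo:
  "subgroup {f \<in> Bij (topspace X). homeomorphic_map X X f} (BijGroup (topspace X))"
proof -
  interpret group "BijGroup (topspace X)" by (rule group_BijGroup)
  have mult: "f \<otimes>\<^bsub>BijGroup (topspace X)\<^esub> g = compose (topspace X) f g"
    if "f \<in> Bij (topspace X)" "g \<in> Bij (topspace X)" for f g
    using that by (simp add: BijGroup_def)
  show ?thesis
  proof (rule subgroupI)
    show "{f \<in> Bij (topspace X). homeomorphic_map X X f} \<subseteq> carrier (BijGroup (topspace X))"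
      by (auto simp: BijGroup_def)
    have "homeomorphic_map X X (\<lambda>x\<in>topspace X. x)"
      by (rule homeomorphic_map_eq[of X X id]) auto
    then show "{f \<in> Bij (topspace X). homeomorphic_map X X f} \<noteq> {}"
      using id_Bij by blast
  next
    fix f assume f: "f \<in> {f \<in> Bij (topspace X). homeomorphic_map X X f}"
    let ?g = "\<lambda>x\<in>topspace X. inv_into (topspace X) f x"
    have inv: "inv\<^bsub>BijGroup (topspace X)\<^esub> f = ?g"
      using f by (simp add: inv_BijGroup)
    from f obtain h where h: "homeomorphic_maps X X f h"
      by (auto simp: homeomorphic_map_maps)
    then have "homeomorphic_map X X h"
      by (simp add: homeomorphic_maps_map)
    moreover have "h x = ?g x" if "x \<in> topspace X" for x
    proof -
      have "h x \<in> topspace X" "f (h x) = x"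
        using h that by (auto simp: homeomorphic_maps_def continuous_map_def)
      moreover have "inj_on f (topspace X)"
        using f by (auto simp: Bij_def bij_betw_def)
      ultimately show ?thesis
        using that by (metis inv_into_f_f restrict_apply')
    qed
    ultimately have "homeomorphic_map X X ?g"
      by (rule homeomorphic_map_eq)
    then show "inv\<^bsub>BijGroup (topspace X)\<^esub> f \<in> {f \<in> Bij (topspace X). homeomorphic_map X X f}"
      using f restrict_inv_into_Bij inv by auto
  next
    fix f g
    assume fg: "f \<in> {f \<in> Bij (topspace X). homeomorphic_map X X f}"
      "g \<in> {f \<in> Bij (topspace X). homeomorphic_map X X f}"
    have "homeomorphic_map X X (f \<circ> g)"
      using fg by (auto intro: homeomorphic_map_compose)
    then have "homeomorphic_map X X (compose (topspace X) f g)"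
      by (rule homeomorphic_map_eq) (simp add: compose_def)
    then show "f \<otimes>\<^bsub>BijGroup (topspace X)\<^esub> g \<in> {f \<in> Bij (topspace X). homeomorphic_map X X f}"
      using fg by (simp add: mult compose_Bij)
  qed
qed

lemma group_Homeo: "group (Homeo X)"
  unfolding Homeo_def by (rule subgroup.subgroup_is_group[OF subgroup_Homeo group_BijGroup])

definition finitely_generated_group :: "('a, 'b) monoid_scheme \<Rightarrow> bool" where
  "finitely_generated_group G \<longleftrightarrow>
     group G \<and> (\<exists>S. finite S \<and> S \<subseteq> carrier G \<and> generate G S = carrier G)"

definition periodic_group :: "('a, 'b) monoid_scheme \<Rightarrow> bool" where
  "periodic_group G \<longleftrightarrow>
     group G \<and> (\<forall>g\<in>carrier G. \<exists>n::nat. n > 0 \<and> g [^]\<^bsub>G\<^esub> n = \<one>\<^bsub>G\<^esub>)"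

text \<open>
  A self-homeomorphism of the \<open>n\<close>-sphere has degree \<open>1\<close> or \<open>-1\<close>; it preserves orientation iff it
  acts trivially on top-dimensional homology, i.e. iff its degree is \<open>1\<close>. The degree depends only
  on the values of the map on the sphere.
\<close>

definition orientation_preserving_homeo :: "nat \<Rightarrow> ((nat \<Rightarrow> real) \<Rightarrow> nat \<Rightarrow> real) \<Rightarrow> bool" where
  "orientation_preserving_homeo n f \<longleftrightarrow>
     homeomorphic_map (nsphere n) (nsphere n) f \<and> Brouwer_degree2 n f = 1"

end

theory Submission
  imports Defs "HOL-Analysis.Analysis" "HOL-Number_Theory.Number_Theory"
begin

text \<open>
  A periodic orientation preserving homeomorphism of the 2-sphere that fixes three points is the
  identity. Granting this, two elements of \<open>G\<close> that agree on an orbit with at least three points are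
  equal, since their quotient is periodic and fixes the orbit pointwise. If the orbit is finite, \<open>G\<close>
  therefore injects into the finite set of self-maps of the orbit.

  The statement on three fixed points is usually read off from Kerekjarto's theorem, by which such a
  homeomorphism is conjugate to a rotation. The following argument avoids the conjugacy. Put one fixed
  point at infinity. This leaves a homeomorphism \<open>f\<close> of the plane that fixes \<open>0\<close> and some \<open>b \<noteq> 0\<close>, and after
  passing to a power \<open>f ^^ p = id\<close> with \<open>p\<close> prime. Preservation of orientation means that \<open>f z = z * exp (l z)\<close>
  for a continuous \<open>l\<close> on the punctured plane (lemma \<open>Brouwer_degree2_eq_minus_1\<close> excludes the other
  sign), and \<open>l b = 0\<close> after subtracting a constant. Then \<open>(f ^^ i) z = z * exp (L i z)\<close>, where \<open>L i\<close> sums \<open>l\<close> over the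
  first \<open>i\<close> points of the orbit. The function \<open>L p\<close> has values in \<open>2 * pi * \<i> * \<int>\<close>, so it is constant, and it
  vanishes at \<open>b\<close>. It follows that the geometric mean of an orbit
    \<open>K z = z * exp ((L 0 z + \<dots> + L (p - 1) z) / p)\<close>
  is a well-defined \<open>f\<close>-invariant continuous map of the plane (lemma \<open>invariant_proper_map_exists\<close>). It is
  proper, it winds once around at infinity, and it is the identity on the fixed points of \<open>f\<close>.

  Suppose now that \<open>f\<close> moves \<open>y\<close>. No fixed point of \<open>f\<close> lies over \<open>y\<close>, so the fibre of \<open>K\<close> over \<open>y\<close> consists
  of orbits with exactly \<open>p\<close> elements. Points of one orbit count with the same multiplicity, so the
  winding number of \<open>K - y\<close> at infinity should be a multiple of \<open>p\<close>; but it is \<open>1\<close>. To make the count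
  meaningful for a fibre that is merely compact, the direction of \<open>K - y\<close> is first changed near the
  fibre, equivariantly and one small disc at a time, to a map into the circle with finitely many
  singularities (lemma \<open>remove_zeros_up_to_finite_set\<close>); the count itself is lemma
  \<open>order_dvd_wraps_at_infinity\<close>.
\<close>

section \<open>Winding exponents on annuli\<close>

text \<open>
  If \<open>A\<close> contains a circle around \<open>a\<close>, then \<open>n\<close> is the winding number around \<open>0\<close> of \<open>h\<close> along that circle.
  Keeping the logarithm \<open>L\<close> on all of \<open>A\<close>, instead of integrating along a path, makes the exponent
  available for merely continuous \<open>h\<close> and lets the logarithm itself be used in later constructions.
\<close>

definition wraps :: "(complex \<Rightarrow> complex) \<Rightarrow> complex \<Rightarrow> int \<Rightarrow> complex set \<Rightarrow> bool" where
  "wraps h a n A \<longleftrightarrow> (\<exists>L. continuous_on A L \<and> (\<forall>z\<in>A. h z = (z - a) powi n * exp (L z)))"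

text \<open>
  The set \<open>I\<close> of radii is meant to be an interval of positive reals. In this way
  punctured discs and punctured planes are covered at once.
\<close>

definition annulus :: "complex \<Rightarrow> real set \<Rightarrow> complex set" where
  "annulus a I = {z. dist a z \<in> I}"

lemma exp_eq_1_imp_constant_on:
  fixes g :: "'a::topological_space \<Rightarrow> complex"
  assumes "connected S" "continuous_on S g" "\<And>z. z \<in> S \<Longrightarrow> exp (g z) = 1"
  shows "g constant_on S"
proof (rule continuous_discrete_range_constant[OF assms(1,2)])
  fix x assume x: "x \<in> S"
  have "2 * pi \<le> norm (g y - g x)" if y: "y \<in> S" "g y \<noteq> g x" for y
  proof -
    obtain j where j: "g x = of_real (2 * pi * of_int j) * \<i>"
      using assms(3)[OF x] exp_eq_1[of "g x"] by (auto simp: complex_eq_iff)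
    obtain k where k: "g y = of_real (2 * pi * of_int k) * \<i>"
      using assms(3)[OF y(1)] exp_eq_1[of "g y"] by (auto simp: complex_eq_iff)
    have "g y - g x = of_real (2 * pi * of_int (k - j)) * \<i>"
      by (simp add: j k algebra_simps)
    then have n: "norm (g y - g x) = 2 * pi * \<bar>of_int (k - j)\<bar>"
      by (simp only: norm_mult norm_of_real norm_ii abs_mult) simp
    have "k \<noteq> j" using j k y(2) by auto
    then have "1 \<le> \<bar>of_int (k - j) :: real\<bar>" by linarith
    then show ?thesis unfolding n by simp
  qed
  then show "\<exists>e>0. \<forall>y. y \<in> S \<and> g y \<noteq> g x \<longrightarrow> e \<le> norm (g y - g x)"
    by (intro exI[of _ "2*pi"]) auto
qed

lemma wraps_subset: "wraps h a n A \<Longrightarrow> B \<subseteq> A \<Longrightarrow> wraps h a n B"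
  unfolding wraps_def by (meson continuous_on_subset subsetD)

lemma wraps_cong: "(\<And>z. z \<in> A \<Longrightarrow> h z = k z) \<Longrightarrow> wraps h a n A \<longleftrightarrow> wraps k a n A"
  unfolding wraps_def by auto

lemma wraps_mult:
  assumes "a \<notin> A" "wraps h a n A" "wraps k a m A"
  shows "wraps (\<lambda>z. h z * k z) a (n + m) A"
proof -
  obtain L where L: "continuous_on A L" "\<And>z. z \<in> A \<Longrightarrow> h z = (z - a) powi n * exp (L z)"
    using assms unfolding wraps_def by auto
  obtain M where M: "continuous_on A M" "\<And>z. z \<in> A \<Longrightarrow> k z = (z - a) powi m * exp (M z)"
    using assms unfolding wraps_def by auto
  have "h z * k z = (z - a) powi (n + m) * exp (L z + M z)" if "z \<in> A" for z
  proof -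
    have "z - a \<noteq> 0" using that assms(1) by auto
    then show ?thesis using L M that by (simp add: power_int_add exp_add)
  qed
  then show ?thesis unfolding wraps_def using L M by (intro exI[of _ "\<lambda>z. L z + M z"]) (auto intro: continuous_intros)
qed

lemma wraps_powi:
  assumes "wraps h a n A"
  shows "wraps (\<lambda>z. h z powi m) a (n * m) A"
proof -
  obtain L where L: "continuous_on A L" "\<And>z. z \<in> A \<Longrightarrow> h z = (z - a) powi n * exp (L z)"
    using assms unfolding wraps_def by auto
  have "h z powi m = (z - a) powi (n * m) * exp (of_int m * L z)" if "z \<in> A" for z
    using that by (simp add: L power_int_mult_distrib power_int_mult exp_power_int)
  then show ?thesis unfolding wraps_def using L by (intro exI[of _ "\<lambda>z. of_int m * L z"]) (auto intro: continuous_intros)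
qed

text \<open>
  Exponents multiply under composition, as degrees do. The function \<open>f - b\<close> takes the place of the local
  coordinate at \<open>b\<close>.
\<close>

lemma wraps_compose:
  assumes "wraps h b n B" "continuous_on A f" "f ` A \<subseteq> B" "wraps (\<lambda>z. f z - b) a m A"
  shows "wraps (\<lambda>z. h (f z)) a (m * n) A"
proof -
  obtain L where L: "continuous_on B L" "\<And>z. z \<in> B \<Longrightarrow> h z = (z - b) powi n * exp (L z)"
    using assms(1) unfolding wraps_def by auto
  obtain M where M: "continuous_on A M" "\<And>z. z \<in> A \<Longrightarrow> (f z - b) powi n = (z - a) powi (m*n) * exp (M z)"
    using wraps_powi[OF assms(4), of n] unfolding wraps_def by auto
  have "h (f z) = (z - a) powi (m * n) * exp (M z + L (f z))" if "z \<in> A" for z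
    using that L(2)[of "f z"] M(2)[of z] assms(3) by (auto simp: exp_add)
  moreover have "continuous_on A (\<lambda>z. M z + L (f z))"
    using assms(2,3) L(1) M(1) by (intro continuous_intros continuous_on_compose2[OF L(1)]) auto
  ultimately show ?thesis unfolding wraps_def by (intro exI[of _ "\<lambda>z. M z + L (f z)"]) auto
qed

text \<open>
  Rouche's principle: the quotient \<open>k z / h z\<close> stays in the right half plane, where the principal
  logarithm is continuous.
\<close>

lemma wraps_perturb:
  assumes "wraps h a n A" "continuous_on A h" "continuous_on A k"
    "\<And>z. z \<in> A \<Longrightarrow> norm (k z - h z) < norm (h z)"
  shows "wraps k a n A"
proof -
  obtain L where L: "continuous_on A L" "\<And>z. z \<in> A \<Longrightarrow> h z = (z - a) powi n * exp (L z)"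
    using assms unfolding wraps_def by auto
  have nz: "h z \<noteq> 0" if "z \<in> A" for z using assms(4)[OF that] by auto
  have re: "Re (k z / h z) > 0" if "z \<in> A" for z
  proof -
    have "norm (k z / h z - 1) < 1"
      using assms(4)[OF that] nz[OF that] by (simp add: norm_divide divide_simps flip: diff_divide_distrib)
    then show ?thesis using abs_Re_le_cmod[of "k z / h z - 1"] by auto
  qed
  have nn: "k z / h z \<notin> \<real>\<^sub>\<le>\<^sub>0" if "z \<in> A" for z
    using re[OF that] by (auto simp: complex_nonpos_Reals_iff)
  have c: "continuous_on A (\<lambda>z. L z + Ln (k z / h z))"
    using nn nz assms L by (intro continuous_intros) auto
  have "k z = (z - a) powi n * exp (L z + Ln (k z / h z))" if "z \<in> A" for z
  proof -
    have "exp (Ln (k z / h z)) = k z / h z" using re[OF that] by (intro exp_Ln) auto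
    then have "h z * exp (Ln (k z / h z)) = k z" using nz[OF that] by simp
    then show ?thesis using L(2)[OF that] by (metis exp_add mult.assoc)
  qed
  then show ?thesis unfolding wraps_def using c by blast
qed

lemma wraps_unique:
  assumes "wraps h a n A" "wraps h a m A" "r > 0" "sphere a r \<subseteq> A"
  shows "n = m"
proof -
  obtain L where L: "continuous_on A L" "\<And>z. z \<in> A \<Longrightarrow> h z = (z - a) powi n * exp (L z)"
    using assms unfolding wraps_def by auto
  obtain M where M: "continuous_on A M" "\<And>z. z \<in> A \<Longrightarrow> h z = (z - a) powi m * exp (M z)"
    using assms unfolding wraps_def by auto
  define w :: "real \<Rightarrow> complex" where "w t = of_real (ln r) + of_real t * \<i>" for t
  have ew: "exp (w t) = of_real r * exp (of_real t * \<i>)" for t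
    using assms(3) by (simp add: w_def exp_add exp_of_real)
  have wA: "a + exp (w t) \<in> A" for t
    using assms(3,4) by (auto simp: dist_norm ew norm_mult)
  define g where "g t = of_int (n - m) * w t + (L (a + exp (w t)) - M (a + exp (w t)))" for t
  have cw: "continuous_on UNIV w" unfolding w_def by (intro continuous_intros)
  have "continuous_on UNIV g" unfolding g_def
    using wA by (intro continuous_intros cw continuous_on_compose2[OF L(1)] continuous_on_compose2[OF M(1)]) auto
  moreover have "exp (g t) = 1" for t
  proof -
    have "exp (of_int n * w t + L (a + exp (w t))) = exp (of_int m * w t + M (a + exp (w t)))"
      using L(2)[OF wA] M(2)[OF wA, of t] by (simp add: exp_add exp_power_int)
    moreover have "g t = (of_int n * w t + L (a + exp (w t))) - (of_int m * w t + M (a + exp (w t)))"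
      by (simp add: g_def algebra_simps)
    ultimately show ?thesis by (simp only: exp_diff) simp
  qed
  ultimately have "g constant_on UNIV" by (intro exp_eq_1_imp_constant_on) auto
  then have "g 0 = g (2 * pi)" by (auto simp: constant_on_def)
  moreover have "exp (w (2*pi)) = exp (w 0)" by (simp add: ew mult.commute)
  ultimately have "of_int (n - m) * w 0 = of_int (n - m) * w (2*pi)" by (simp add: g_def)
  then show ?thesis by (auto simp: w_def)
qed

text \<open>
  The exponential map unrolls the annulus to a vertical strip. The strip is contractible, so there
  \<open>h\<close> has a logarithm \<open>M\<close>, and \<open>M\<close> grows by a constant multiple of \<open>2 * pi * \<i>\<close> along the period of the
  exponential. Subtracting the right multiple of the coordinate leaves a periodic function, which
  descends to the annulus.
\<close>

lemma wraps_exists: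
  assumes I: "is_interval I" "I \<subseteq> {0<..}"
    and h: "continuous_on (annulus a I) h" "\<And>z. z \<in> annulus a I \<Longrightarrow> h z \<noteq> 0"
  obtains n where "wraps h a n (annulus a I)"
proof -
  define W where "W = {w::complex. exp (Re w) \<in> I}"
  have convW: "convex W"
  proof (rule convexI)
    fix x y :: complex and u v :: real
    assume xy: "x \<in> W" "y \<in> W" and uv: "0 \<le> u" "0 \<le> v" "u + v = 1"
    have "convex {t. exp t \<in> I}"
    proof -
      have "is_interval {t. exp t \<in> I}"
        unfolding is_interval_1
      proof (intro ballI allI impI)
        fix s t x :: real assume "s \<in> {t. exp t \<in> I}" "t \<in> {t. exp t \<in> I}" "s \<le> x \<and> x \<le> t"
        then show "x \<in> {t. exp t \<in> I}"
          using mem_is_interval_1_I[OF I(1), of "exp s" "exp t" "exp x"] by simp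
      qed
      then show ?thesis by (simp add: is_interval_convex)
    qed
    from convexD[OF this, of "Re x" "Re y" u v] xy uv show "u *\<^sub>R x + v *\<^sub>R y \<in> W"
      by (auto simp: W_def)
  qed
  have inA: "a + exp w \<in> annulus a I \<longleftrightarrow> w \<in> W" for w
    by (simp add: annulus_def W_def dist_norm)
  have "continuous_on W (\<lambda>w. h (a + exp w))"
    by (rule continuous_on_compose2[OF h(1)]) (auto intro!: continuous_intros simp: inA)
  then obtain M where M: "continuous_on W M" "\<And>w. w \<in> W \<Longrightarrow> h (a + exp w) = exp (M w)"
    using continuous_logarithm_on_contractible[of W "\<lambda>w. h (a + exp w)"] convex_imp_contractible[OF convW]
    h(2) inA by metis
  define c where "c = 2 * of_real pi * \<i>"
  have ec: "exp (w + c) = exp w" for w by (simp add: c_def exp_add mult.commute)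
  have Wc: "w + c \<in> W \<longleftrightarrow> w \<in> W" for w by (simp add: W_def c_def)
  have "(\<lambda>w. M (w + c) - M w) constant_on W"
  proof (rule exp_eq_1_imp_constant_on)
    show "continuous_on W (\<lambda>w. M (w + c) - M w)"
      by (intro continuous_intros M(1) continuous_on_compose2[OF M(1)]) (auto simp: Wc)
    show "exp (M (w + c) - M w) = 1" if "w \<in> W" for w
      using M(2)[of w] M(2)[of "w + c"] that Wc[of w] by (simp add: exp_diff ec)
  qed (use convW convex_connected in auto)
  then obtain d where d: "\<And>w. w \<in> W \<Longrightarrow> M (w + c) = M w + d"
    unfolding constant_on_def by (metis add.commute diff_eq_eq)
  (* For an empty annulus any exponent will do. *)
  obtain n where n: "W \<noteq> {} \<Longrightarrow> d = of_int n * c"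
  proof (cases "W = {}")
    case False
    then obtain w where w: "w \<in> W" by auto
    have "exp (M (w + c)) = exp (M w)" using M(2)[of w] M(2)[of "w + c"] w Wc[of w] by (simp add: ec)
    then have "exp d = 1" using d[OF w] by (simp add: exp_add)
    then obtain k::int where "Re d = 0" "Im d = of_int (2*k)*pi" using exp_eq_1[of d] by auto
    then have "d = of_int k * c" by (simp add: complex_eq_iff c_def)
    then show thesis using that by blast
  qed auto
  define P where "P w = M w - of_int n * w" for w
  have P1: "P (w + c) = P w" if "w \<in> W" for w
    using d[OF that] n that by (auto simp: P_def algebra_simps)
  have Pnat: "P (w + of_nat k * c) = P w \<and> w + of_nat k * c \<in> W" if "w \<in> W" for w k
  proof (induction k)
    case (Suc k)
    then show ?case using P1[of "w + of_nat k * c"] Wc[of "w + of_nat k * c"] by (simp add: algebra_simps)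
  qed (use that in auto)
  have Pint: "P (w + of_int k * c) = P w" if "w \<in> W" for w k
  proof (cases "k \<ge> 0")
    case True
    then show ?thesis using Pnat[OF that, of "nat k"] by simp
  next
    case False
    have "w + of_int k * c \<in> W" using that by (simp add: W_def c_def)
    from Pnat[OF this, of "nat (-k)"] False show ?thesis by simp
  qed
  have Peq: "P w = P w'" if ww: "w \<in> W" "exp w = exp w'" for w w'
  proof -
    obtain k::int where "w' = w + of_int (2*k) * pi * \<i>" using ww(2) exp_eq[of w' w] by auto
    then have "w' = w + of_int k * c" by (simp add: c_def)
    then show ?thesis using Pint[OF ww(1), of k] by simp
  qed
  (* By Peq the choice of the branch of the logarithm does not matter, so the cut of Ln causes no jump. *)
  define L where "L z = P (Ln (z - a))" for z
  have nz: "z \<noteq> a" if "z \<in> annulus a I" for z using that I(2) by (auto simp: annulus_def)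
  have contP: "continuous_on W P" unfolding P_def by (intro continuous_intros M)
  have "continuous_on (annulus a I) L"
    unfolding continuous_on_eq_continuous_within
  proof
    fix z0 assume z0: "z0 \<in> annulus a I"
    define w where "w z = Ln (z0 - a) + Ln ((z - a) / (z0 - a))" for z
    define N where "N = annulus a I \<inter> ball z0 (norm (z0 - a))"
    have zN: "z0 \<in> N" using z0 nz by (auto simp: N_def)
    have ew: "exp (w z) = z - a" if "z \<in> N" for z
      using that nz z0 by (auto simp: w_def exp_add N_def)
    have wW: "w z \<in> W" if "z \<in> N" for z
      using inA[of "w z"] ew[OF that] that by (auto simp: N_def)
    have "(z - a) / (z0 - a) \<notin> \<real>\<^sub>\<le>\<^sub>0" if "z \<in> N" for z
    proof -
      have "norm ((z - a) / (z0 - a) - 1) < 1"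
        using that nz[OF z0] by (simp add: norm_divide divide_simps N_def dist_norm norm_minus_commute flip: diff_divide_distrib)
      then have "Re ((z - a) / (z0 - a)) > 0" using abs_Re_le_cmod[of "(z - a) / (z0 - a) - 1"] by auto
      then show ?thesis by (auto simp: complex_nonpos_Reals_iff)
    qed
    then have "continuous_on N w" unfolding w_def using nz[OF z0] by (intro continuous_intros) auto
    then have "continuous_on N (\<lambda>z. P (w z))"
      by (rule continuous_on_compose2[OF contP]) (use wW in auto)
    moreover have "P (w z) = L z" if "z \<in> N" for z
      unfolding L_def using wW[OF that] ew[OF that] that nz[of z] by (intro Peq) (auto simp: N_def)
    ultimately have "continuous_on N L" by (simp cong: continuous_on_cong)
    then have "continuous (at z0 within N) L" using zN by (simp add: continuous_on_eq_continuous_within)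
    moreover have "at z0 within annulus a I = at z0 within N"
      using nz[OF z0] by (intro at_within_nhd[of z0 "ball z0 (norm (z0 - a))"]) (auto simp: N_def)
    ultimately show "continuous (at z0 within annulus a I) L" by simp
  qed
  moreover have "h z = (z - a) powi n * exp (L z)" if "z \<in> annulus a I" for z
  proof -
    have e: "exp (Ln (z - a)) = z - a" using nz[OF that] by simp
    have "Ln (z - a) \<in> W" using inA[of "Ln (z - a)"] that e by simp
    from M(2)[OF this] have "h z = exp (of_int n * Ln (z - a) + P (Ln (z - a)))"
      using e by (simp add: P_def)
    then show ?thesis by (simp add: exp_add L_def e flip: exp_power_int)
  qed
  ultimately show thesis using that unfolding wraps_def by blast
qed

lemma wraps_translate_at_infinity:
  assumes "norm a \<le> R"
  shows "wraps (\<lambda>z. z - a) 0 1 {z. R < norm z}"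
proof (rule wraps_perturb[where h = "\<lambda>z. z"])
  show "wraps (\<lambda>z. z) 0 1 {z. R < norm z}" unfolding wraps_def
    by (intro exI[of _ "\<lambda>z. 0"]) auto
qed (use assms in \<open>auto intro!: continuous_intros\<close>)

lemma wraps_0_on_contractible:
  assumes "contractible A" "continuous_on A h" "\<And>z. z \<in> A \<Longrightarrow> h z \<noteq> 0"
  shows "wraps h a 0 A"
  using continuous_logarithm_on_contractible[OF assms(2,1,3)] unfolding wraps_def by (metis mult_1 power_int_0_right)

text \<open>
  The argument principle for a continuous function with finitely many singularities: the winding at
  infinity is the sum of the local ones. One singularity is removed at a time. After division by
  \<open>(z - a) powi n a\<close> the function has a logarithm on the circle of radius \<open>\<rho> / 2\<close> around \<open>a\<close>; a Tietze
  extension of this logarithm fills in the disc.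
\<close>

lemma wraps_at_infinity_eq_sum:
  assumes "finite F" "continuous_on (- F) \<psi>" "\<And>z. z \<notin> F \<Longrightarrow> \<psi> z \<noteq> 0" "0 < \<rho>"
    and "\<And>a b. a \<in> F \<Longrightarrow> b \<in> F \<Longrightarrow> a \<noteq> b \<Longrightarrow> 2 * \<rho> \<le> dist a b"
    and "\<And>a. a \<in> F \<Longrightarrow> wraps \<psi> a (n a) (annulus a {0<..<\<rho>})"
    and "wraps \<psi> 0 m {z. R < norm z}"
  shows "m = (\<Sum>a\<in>F. n a)"
  using assms
proof (induction F arbitrary: \<psi> m R rule: finite_induct)
  case empty
  have "wraps \<psi> 0 0 UNIV" using empty by (intro wraps_0_on_contractible) auto
  then have "wraps \<psi> 0 0 {z. R < norm z}" by (rule wraps_subset) simp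
  moreover have "sphere 0 (\<bar>R\<bar> + 1) \<subseteq> {z::complex. R < norm z}" by (auto simp: sphere_def)
  ultimately show ?case using wraps_unique[OF empty(6), of 0 "\<bar>R\<bar> + 1"] by simp
next
  case (insert a F)
  define A where "A = annulus a {0<..<\<rho>}"
  obtain L where L: "continuous_on A L" "\<And>z. z \<in> A \<Longrightarrow> \<psi> z = (z - a) powi n a * exp (L z)"
    using insert.prems(5)[of a] unfolding wraps_def A_def by auto
  have sA: "sphere a (\<rho>/2) \<subseteq> A" using \<open>0 < \<rho>\<close> by (auto simp: A_def annulus_def)
  have "continuous_on (sphere a (\<rho>/2)) L" using L(1) sA by (rule continuous_on_subset)
  then obtain M where M: "continuous_on UNIV M" "\<And>z. z \<in> sphere a (\<rho>/2) \<Longrightarrow> M z = L z"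
    by (rule Tietze_unbounded[of _ L UNIV]) auto
  define g where "g z = (if z \<in> cball a (\<rho>/2) then exp (M z) else \<psi> z * (z - a) powi (- n a))" for z
  have g_sphere: "exp (M z) = \<psi> z * (z - a) powi (- n a)" if "z \<in> sphere a (\<rho>/2)" for z
  proof -
    have "z - a \<noteq> 0" using that \<open>0 < \<rho>\<close> by auto
    then show ?thesis using that L(2)[of z] M(2)[of z] sA by (auto simp: power_int_minus field_simps)
  qed
  have aF: "a \<notin> F" using insert by simp
  have far: "2 * \<rho> \<le> dist a b" if "b \<in> F" for b using insert.prems(4)[of a b] that aF by auto
  have contg: "continuous_on (- F) g"
  proof -
    have "continuous_on ((- F \<inter> cball a (\<rho>/2)) \<union> (- F - ball a (\<rho>/2))) g"
    proof (rule continuous_on_Un_local)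
      let ?U = "(- F \<inter> cball a (\<rho>/2)) \<union> (- F - ball a (\<rho>/2))"
      have "- F \<inter> cball a (\<rho>/2) = ?U \<inter> cball a (\<rho>/2)" by auto
      then show "closedin (top_of_set ?U) (- F \<inter> cball a (\<rho>/2))" by (metis closedin_closed_Int closed_cball)
      have "- F - ball a (\<rho>/2) = ?U \<inter> - ball a (\<rho>/2)" by auto
      moreover have "closed (- ball a (\<rho>/2))" by (simp add: closed_Compl)
      ultimately show "closedin (top_of_set ?U) (- F - ball a (\<rho>/2))" by (metis closedin_closed_Int)
      have "continuous_on (- F \<inter> cball a (\<rho>/2)) (\<lambda>z. exp (M z))"
        using M(1) by (intro continuous_intros) (auto intro: continuous_on_subset)
      then show "continuous_on (- F \<inter> cball a (\<rho>/2)) g" by (rule continuous_on_eq) (simp add: g_def)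
      have "continuous_on (- F - ball a (\<rho>/2)) (\<lambda>z. \<psi> z * (z - a) powi (- n a))"
        using insert.prems(1) \<open>0 < \<rho>\<close> by (intro continuous_intros) (auto intro: continuous_on_subset)
      then show "continuous_on (- F - ball a (\<rho>/2)) g"
        by (rule continuous_on_eq) (use g_sphere in \<open>auto simp: g_def\<close>)
    qed
    moreover have "(- F \<inter> cball a (\<rho>/2)) \<union> (- F - ball a (\<rho>/2)) = - F" by auto
    ultimately show ?thesis by simp
  qed
  have nz: "g z \<noteq> 0" if "z \<notin> F" for z
  proof (cases "z \<in> cball a (\<rho>/2)")
    case False
    then have "z \<noteq> a" using \<open>0 < \<rho>\<close> by auto
    then show ?thesis using False insert.prems(2)[of z] that by (simp add: g_def)
  qed (simp add: g_def)
  have wb: "wraps g b (n b) (annulus b {0<..<\<rho>})" if b: "b \<in> F" for b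
  proof -
    have sub: "z \<noteq> a \<and> z \<notin> cball a (\<rho>/2)" if "z \<in> ball b \<rho>" for z
    proof -
      have "dist a b \<le> dist a z + dist b z" by (metis dist_commute dist_triangle)
      then show ?thesis using far[OF b] that \<open>0 < \<rho>\<close> by auto
    qed
    have "wraps (\<lambda>z. (z - a) powi (- n a)) b 0 (ball b \<rho>)"
      using sub by (intro wraps_0_on_contractible convex_imp_contractible continuous_intros) auto
    then have "wraps (\<lambda>z. (z - a) powi (- n a)) b 0 (annulus b {0<..<\<rho>})"
      by (rule wraps_subset) (auto simp: annulus_def)
    then have "wraps (\<lambda>z. \<psi> z * (z - a) powi (- n a)) b (n b + 0) (annulus b {0<..<\<rho>})"
      using insert.prems(5)[of b] b by (intro wraps_mult) (auto simp: annulus_def)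
    then show ?thesis
      using sub by (subst wraps_cong[where k = "\<lambda>z. \<psi> z * (z - a) powi (- n a)"]) (auto simp: g_def annulus_def)
  qed
  define R' where "R' = Max {R, norm a, norm a + \<rho>, 0}"
  have R': "R \<le> R'" "norm a \<le> R'" "norm a + \<rho> \<le> R'" "0 \<le> R'" by (auto simp: R'_def)
  have "wraps (\<lambda>z. (z - a) powi (- n a)) 0 (1 * (- n a)) {z. R' < norm z}"
    using R' by (intro wraps_powi wraps_translate_at_infinity) auto
  moreover have "wraps \<psi> 0 m {z. R' < norm z}"
    using insert.prems(6) by (rule wraps_subset) (use R'(1) in auto)
  ultimately have "wraps (\<lambda>z. \<psi> z * (z - a) powi (- n a)) 0 (m + 1 * (- n a)) {z. R' < norm z}"
    using R' by (intro wraps_mult) auto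
  moreover have "z \<notin> cball a (\<rho>/2)" if "R' < norm z" for z
  proof -
    have "norm z \<le> norm a + dist a z" by (metis dist_norm norm_minus_commute norm_triangle_sub)
    then show ?thesis using R' that \<open>0 < \<rho>\<close> by auto
  qed
  ultimately have "wraps g 0 (m - n a) {z. R' < norm z}"
    by (subst wraps_cong[where k = "\<lambda>z. \<psi> z * (z - a) powi (- n a)"]) (auto simp: g_def)
  from insert.IH[OF contg nz \<open>0 < \<rho>\<close> insert.prems(4) wb this]
  have "m - n a = (\<Sum>a\<in>F. n a)" by auto
  then show ?case using insert.hyps by simp
qed

section \<open>Invariant circle-valued maps of a periodic plane homeomorphism\<close>

lemma continuous_on_finite_closed_cover:
  assumes "finite I" "\<And>i. i \<in> I \<Longrightarrow> closed (T i)" "Y \<subseteq> (\<Union>i\<in>I. T i)"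
    "\<And>i. i \<in> I \<Longrightarrow> continuous_on (Y \<inter> T i) g"
  shows "continuous_on Y g"
proof -
  have "continuous_map (top_of_set Y) euclidean g"
  proof (rule pasting_lemma_closed[where I = I and T = "\<lambda>i. Y \<inter> T i" and f = "\<lambda>i. g"])
    show "closedin (top_of_set Y) (Y \<inter> T i)" if "i \<in> I" for i
      using assms(2)[OF that] by (simp add: closedin_closed_Int)
    show "continuous_map (subtopology (top_of_set Y) (Y \<inter> T i)) euclidean g" if "i \<in> I" for i
      using assms(4)[OF that] by (simp add: subtopology_subtopology)
  qed (use assms in auto)
  then show ?thesis by simp
qed

text \<open>
  Maps from a compact subset of the plane to the circle extend to the plane except for finitely many
  points. The set \<open>Z - F\<close> is not compact, but \<open>\<psi>\<close> need not be extended near \<open>F\<close>, which lies in the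
  interior of \<open>Z\<close>: small discs around \<open>F\<close> are cut out first. The new singularities are kept off the
  boundary circle of the disc, so that they are interior to the enlarged domain and the construction
  can be repeated.
\<close>

lemma extend_circle_map_over_cball:
  fixes \<psi> :: "complex \<Rightarrow> complex"
  assumes Z: "closed Z" "finite F" "F \<subseteq> interior Z"
    and \<psi>: "continuous_on (Z - F) \<psi>" "\<psi> ` (Z - F) \<subseteq> sphere 0 1"
  obtains K g where "finite K" "K \<subseteq> ball s r - Z" "continuous_on (cball s r - (F \<union> K)) g"
    "g ` (cball s r - (F \<union> K)) \<subseteq> sphere 0 1" "\<And>z. z \<in> Z - F \<Longrightarrow> g z = \<psi> z"
proof -
  define U where "U = (\<Union>a\<in>F. ball a (SOME e. e > 0 \<and> ball a e \<subseteq> Z))"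
  have e: "(SOME e. e > 0 \<and> ball a e \<subseteq> Z) > 0 \<and> ball a (SOME e. e > 0 \<and> ball a e \<subseteq> Z) \<subseteq> Z"
    if "a \<in> F" for a
    using Z(3) that mem_interior[of a Z] by (intro someI_ex[of "\<lambda>e. e > 0 \<and> ball a e \<subseteq> Z"]) auto
  have U: "open U" "F \<subseteq> U" "U \<subseteq> Z"
    using e by (auto simp: U_def)
  define A where "A = Z \<inter> cball s r - U"
  have "compact A" unfolding A_def
    using Z(1) U(1) by (intro compact_diff closed_Int_compact) auto
  have AZ: "A \<subseteq> Z - F" using U by (auto simp: A_def)
  (* L is where new singularities may be placed; a circle has empty interior, so L meets every
     component of the complement of A. *)
  define L where "L = - (A \<union> sphere s r)"
  have meets: "C \<inter> L \<noteq> {}" if "C \<in> components (UNIV - A)" "bounded C" for C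
  proof
    assume "C \<inter> L = {}"
    moreover have "C \<inter> A = {}" using in_components_subset[OF that(1)] by auto
    ultimately have "C \<subseteq> sphere s r" by (auto simp: L_def)
    then have "negligible C" using negligible_sphere negligible_subset by blast
    moreover have "open C"
      using open_components[OF _ that(1)] \<open>compact A\<close> by (simp add: compact_imp_closed open_Diff)
    ultimately show False using open_not_negligible in_components_nonempty[OF that(1)] by blast
  qed
  have aff: "aff_dim (UNIV::complex set) \<le> DIM(complex)" by simp
  have "continuous_on A \<psi>" "\<psi> \<in> A \<rightarrow> sphere 0 1"
    using \<psi> AZ by (auto intro: continuous_on_subset)
  from extend_map_affine_to_sphere_cofinite[OF \<open>compact A\<close> affine_UNIV subset_UNIV aff zero_le_one this meets]
  obtain K h where K: "finite K" "K \<subseteq> L" "disjnt K A" and h: "continuous_on (UNIV - K) h"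
    "h \<in> (UNIV - K) \<rightarrow> sphere 0 1" "\<And>z. z \<in> A \<Longrightarrow> h z = \<psi> z"
    by metis
  define K' where "K' = K \<inter> cball s r - Z"
  define g where "g z = (if z \<in> Z then \<psi> z else h z)" for z
  define P where "P = Z \<inter> cball s r - F"
  define Q where "Q = cball s r - U - K"
  have PQ: "cball s r - (F \<union> K') = P \<union> Q" using U by (auto simp: P_def Q_def K'_def)
  have "continuous_on (P \<union> Q) g"
  proof (rule continuous_on_Un_local)
    have "P = (P \<union> Q) \<inter> Z" using U by (auto simp: P_def Q_def)
    then show "closedin (top_of_set (P \<union> Q)) P" using Z(1) by (metis closedin_closed_Int)
    have "Q = (P \<union> Q) \<inter> (- U)" using U K by (auto simp: P_def Q_def A_def disjnt_def)
    moreover have "closed (- U)" using U(1) by (rule closed_Compl)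
    ultimately show "closedin (top_of_set (P \<union> Q)) Q" by (metis closedin_closed_Int)
    have "continuous_on P \<psi>" using \<psi>(1) by (rule continuous_on_subset) (auto simp: P_def)
    then show "continuous_on P g" by (rule continuous_on_eq) (auto simp: g_def P_def)
    have "continuous_on Q h" using h(1) by (rule continuous_on_subset) (auto simp: Q_def)
    then show "continuous_on Q g" by (rule continuous_on_eq) (auto simp: g_def Q_def A_def h(3))
  qed
  moreover have "g z \<in> sphere 0 1" if "z \<in> P \<union> Q" for z
  proof (cases "z \<in> Z")
    case True
    then have "z \<in> Z - F" using that U by (auto simp: P_def Q_def)
    then show ?thesis using True \<psi>(2) by (auto simp: g_def)
  next
    case False
    then show ?thesis using that h(2) by (auto simp: g_def P_def Q_def Pi_iff)
  qed
  moreover have "finite K'" "K' \<subseteq> ball s r - Z" using K by (auto simp: K'_def L_def)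
  moreover have "g z = \<psi> z" if "z \<in> Z - F" for z using that by (simp add: g_def)
  ultimately show thesis
    unfolding PQ[symmetric] by (intro that[of K' g]) blast+
qed

locale periodic_plane_map =
  fixes f :: "complex \<Rightarrow> complex" and p :: nat
  assumes p_pos: "0 < p"
    and cont: "continuous_on UNIV f"
    and per: "(f ^^ p) z = z"
begin

lemma cont_iter: "continuous_on A (f ^^ k)"
proof (induction k)
  case 0
  show ?case by (simp add: id_def)
next
  case (Suc k)
  then show ?case using continuous_on_compose2[OF cont Suc] by (simp add: o_def)
qed

lemma iter_mod: "(f ^^ (k mod p)) z = (f ^^ k) z"
proof -
  have "((f ^^ p) ^^ j) z = z" for j z by (induction j) (auto simp: per)
  then have "(f ^^ (p * (k div p))) x = x" for x by (simp add: funpow_mult)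
  then have "(f ^^ (k mod p + p * (k div p))) z = (f ^^ (k mod p)) z"
    by (simp only: funpow_add o_apply)
  moreover have "k mod p + p * (k div p) = k" by simp
  ultimately show ?thesis by metis
qed

lemma iter_inverse: "k \<le> p \<Longrightarrow> (f ^^ (p - k)) ((f ^^ k) z) = z"
  by (metis comp_apply funpow_add le_add_diff_inverse2 per)

lemma inj_f: "inj f"
  using iter_inverse[of 1] p_pos by (intro injI) (metis Suc_leI One_nat_def funpow.simps comp_apply id_apply)

lemma inj_iter: "inj (f ^^ k)"
  using inj_f by (rule inj_fn)

lemma invariant_iter: "(\<And>z. f z \<in> Z \<longleftrightarrow> z \<in> Z) \<Longrightarrow> (f ^^ k) z \<in> Z \<longleftrightarrow> z \<in> Z"
  by (induction k) auto

definition moved_freely :: "complex set \<Rightarrow> bool" where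
  "moved_freely D \<longleftrightarrow> (\<forall>z\<in>D. \<forall>k. 0 < k \<and> k < p \<longrightarrow> (f ^^ k) z \<notin> D)"

definition saturation :: "complex set \<Rightarrow> complex set" where
  "saturation D = (\<Union>j<p. (f ^^ j) -` D)"

text \<open>
  These conditions are the invariant of an induction that enlarges the closed set \<open>Z\<close> disc by disc. The
  set \<open>F\<close> collects the singularities. It is required to be interior to \<open>Z\<close> so that later steps, which
  change nothing on \<open>Z\<close>, do not affect the local winding around the points of \<open>F\<close>.
\<close>

definition invariant_circle_map :: "complex set \<Rightarrow> complex set \<Rightarrow> (complex \<Rightarrow> complex) \<Rightarrow> bool" where
  "invariant_circle_map Z F \<psi> \<longleftrightarrow>
     closed Z \<and> (\<forall>z. f z \<in> Z \<longleftrightarrow> z \<in> Z) \<and>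
     finite F \<and> F \<subseteq> interior Z \<and> (\<forall>z. f z \<in> F \<longleftrightarrow> z \<in> F) \<and>
     (\<forall>a\<in>F. \<forall>k. 0 < k \<and> k < p \<longrightarrow> (f ^^ k) a \<noteq> a) \<and>
     continuous_on (Z - F) \<psi> \<and> \<psi> ` (Z - F) \<subseteq> sphere 0 1 \<and> (\<forall>z\<in>Z - F. \<psi> (f z) = \<psi> z)"

lemma saturation_invariant: "f z \<in> saturation D \<longleftrightarrow> z \<in> saturation D"
proof
  assume "f z \<in> saturation D"
  then obtain j where j: "j < p" "(f ^^ Suc j) z \<in> D" by (auto simp: saturation_def funpow_Suc_right simp del: funpow.simps)
  then have "(f ^^ (Suc j mod p)) z \<in> D" using iter_mod[of "Suc j" z] by simp
  then show "z \<in> saturation D" using p_pos by (auto simp: saturation_def simp del: funpow.simps)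
next
  assume "z \<in> saturation D"
  then obtain j where j: "j < p" "(f ^^ j) z \<in> D" by (auto simp: saturation_def)
  have "(f ^^ (j + (p - 1))) (f z) = (f ^^ j) ((f ^^ Suc (p - 1)) z)"
    by (simp only: funpow_add funpow_Suc_right o_apply)
  then have "(f ^^ (j + (p - 1))) (f z) \<in> D" using j p_pos per by (simp del: funpow.simps)
  then have "(f ^^ ((j + (p - 1)) mod p)) (f z) \<in> D" by (simp add: iter_mod)
  then show "f z \<in> saturation D" using p_pos unfolding saturation_def by (meson UN_iff lessThan_iff mod_less_divisor vimageI2)
qed

lemma subset_saturation: "D \<subseteq> saturation D"
  using p_pos by (force simp: saturation_def)

lemma moved_freely_unique:
  assumes "moved_freely D" "i < p" "j < p" "(f ^^ i) z \<in> D" "(f ^^ j) z \<in> D"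
  shows "i = j"
proof -
  have False if "k < l" "l < p" "(f ^^ k) z \<in> D" "(f ^^ l) z \<in> D" for k l
  proof -
    have "(f ^^ (l - k)) ((f ^^ k) z) = (f ^^ l) z"
      using that(1) by (metis comp_apply funpow_add le_add_diff_inverse2 less_imp_le)
    moreover have "0 < l - k" "l - k < p" using that by auto
    ultimately show False using assms(1) that unfolding moved_freely_def by metis
  qed
  then show ?thesis using assms(2-5) by (meson linorder_neqE_nat)
qed

text \<open>
  The translates of a freely moved disc are disjoint. An arbitrary extension over one of them can
  therefore be transported to the others by \<open>f\<close>, and the result is invariant.
\<close>

lemma extend_over_free_cball:
  assumes \<psi>: "invariant_circle_map Z F \<psi>" and D: "moved_freely (cball s r)"
  obtains F' \<psi>' where "invariant_circle_map (Z \<union> saturation (cball s r)) F' \<psi>'"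
    "F' \<inter> Z = F" "\<And>z. z \<in> Z - F \<Longrightarrow> \<psi>' z = \<psi> z"
proof -
  have cZ: "closed Z" and fZ: "\<And>z. f z \<in> Z \<longleftrightarrow> z \<in> Z" and finF: "finite F"
    and intF: "F \<subseteq> interior Z" and fF: "\<And>z. f z \<in> F \<longleftrightarrow> z \<in> F"
    and freeF: "\<And>a k. a \<in> F \<Longrightarrow> 0 < k \<Longrightarrow> k < p \<Longrightarrow> (f ^^ k) a \<noteq> a"
    and contZ: "continuous_on (Z - F) \<psi>" and imZ: "\<psi> ` (Z - F) \<subseteq> sphere 0 1"
    and invZ: "\<And>z. z \<in> Z \<Longrightarrow> z \<notin> F \<Longrightarrow> \<psi> (f z) = \<psi> z"
    using \<psi> unfolding invariant_circle_map_def by auto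
  obtain K g where K: "finite K" "K \<subseteq> ball s r - Z" and g: "continuous_on (cball s r - (F \<union> K)) g"
    "g ` (cball s r - (F \<union> K)) \<subseteq> sphere 0 1" "\<And>z. z \<in> Z - F \<Longrightarrow> g z = \<psi> z"
    using extend_circle_map_over_cball[OF cZ finF intF contZ imZ, of s r] by metis
  define E where "E = F \<union> saturation K"
  define Y where "Y = (Z \<union> saturation (cball s r)) - E"
  define \<theta> where "\<theta> z = (if z \<in> Z then \<psi> z else g ((f ^^ (SOME j. j < p \<and> (f ^^ j) z \<in> cball s r)) z))" for z
  have itZ: "(f ^^ k) z \<in> Z \<longleftrightarrow> z \<in> Z" for k z by (rule invariant_iter) (rule fZ)
  have itF: "(f ^^ k) z \<in> F \<longleftrightarrow> z \<in> F" for k z by (rule invariant_iter) (rule fF)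
  have FZ: "F \<subseteq> Z" using intF interior_subset by (rule order_trans)
  have KZ: "saturation K \<inter> Z = {}" using K itZ by (auto simp: saturation_def)
  have psi_it: "\<psi> ((f ^^ k) z) = \<psi> z" if "z \<in> Z - F" for z k
  proof (induction k)
    case (Suc k)
    then show ?case using invZ[of "(f ^^ k) z"] that itZ itF by simp
  qed simp
  have \<theta>Z: "\<theta> z = \<psi> z" if "z \<in> Z" for z using that by (simp add: \<theta>_def)
  have \<theta>D: "\<theta> z = g ((f ^^ j) z)" if "j < p" "(f ^^ j) z \<in> cball s r" "z \<notin> F" for j z
  proof (cases "z \<in> Z")
    case True
    then show ?thesis using g(3)[of "(f ^^ j) z"] psi_it[of z j] that itZ itF by (auto simp: \<theta>_def)
  next
    case False
    have "(SOME j. j < p \<and> (f ^^ j) z \<in> cball s r) = j"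
      using moved_freely_unique[OF D] that by (intro some_equality) auto
    then show ?thesis using False by (simp add: \<theta>_def)
  qed
  have dom: "(f ^^ j) z \<in> cball s r - (F \<union> K)" if "j < p" "(f ^^ j) z \<in> cball s r" "z \<in> Y" for j z
    using that itF by (auto simp: Y_def E_def saturation_def)
  have cov: "Y \<subseteq> Z \<union> (\<Union>j<p. (f ^^ j) -` cball s r)" by (auto simp: Y_def saturation_def)
  have clo: "closed ((f ^^ j) -` cball s r)" for j
    using cont_iter[of UNIV j] by (intro continuous_closed_vimage closed_cball) (simp add: continuous_on_eq_continuous_at)
  have contY: "continuous_on Y \<theta>"
  proof (rule continuous_on_finite_closed_cover[where I = "{..p}"
        and T = "\<lambda>j. if j = p then Z else (f ^^ j) -` cball s r"])
    show "Y \<subseteq> (\<Union>i\<in>{..p}. if i = p then Z else (f ^^ i) -` cball s r)" using cov by force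
    show "closed (if i = p then Z else (f ^^ i) -` cball s r)" for i using clo cZ by simp
    show "continuous_on (Y \<inter> (if i = p then Z else (f ^^ i) -` cball s r)) \<theta>" if "i \<in> {..p}" for i
    proof (cases "i = p")
      case True
      have "continuous_on (Y \<inter> Z) \<psi>" using contZ by (rule continuous_on_subset) (auto simp: Y_def E_def)
      then have "continuous_on (Y \<inter> Z) \<theta>" by (rule continuous_on_eq) (simp add: \<theta>Z)
      then show ?thesis using True by simp
    next
      case False
      then have i: "i < p" using that by simp
      have "continuous_on (Y \<inter> (f ^^ i) -` cball s r) (\<lambda>z. g ((f ^^ i) z))"
        using dom[OF i] by (intro continuous_on_compose2[OF g(1) cont_iter]) auto
      then show ?thesis using False i by (rule_tac continuous_on_eq) (auto simp: \<theta>D Y_def E_def)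
    qed
  qed auto
  have fE: "f z \<in> E \<longleftrightarrow> z \<in> E" for z using fF saturation_invariant[of z K] by (simp add: E_def)
  have im: "\<theta> z \<in> sphere 0 1" if z: "z \<in> Y" for z
  proof (cases "z \<in> Z")
    case True
    then have "z \<in> Z - F" using z by (simp add: Y_def E_def)
    then show ?thesis using True imZ by (auto simp: \<theta>Z)
  next
    case False
    then obtain j where j: "j < p" "(f ^^ j) z \<in> cball s r" using z cov by auto
    have "g ((f ^^ j) z) \<in> sphere 0 1" using dom[OF j z] g(2) by (rule_tac subsetD) auto
    moreover have "z \<notin> F" using z by (simp add: Y_def E_def)
    ultimately show ?thesis using \<theta>D[OF j] by simp
  qed
  have inv: "\<theta> (f z) = \<theta> z" if z: "z \<in> Y" for z
  proof (cases "z \<in> Z")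
    case True
    then show ?thesis using fZ invZ z by (auto simp: \<theta>Z Y_def E_def)
  next
    case False
    then obtain j where j: "j < p" "(f ^^ j) z \<in> cball s r" using z cov by auto
    define i where "i = (j + (p - 1)) mod p"
    have "(f ^^ i) (f z) = (f ^^ j) ((f ^^ Suc (p - 1)) z)"
      unfolding i_def iter_mod by (simp only: funpow_add funpow_Suc_right o_apply)
    then have i: "(f ^^ i) (f z) = (f ^^ j) z" "i < p" using p_pos per by (simp_all add: i_def del: funpow.simps)
    have "z \<notin> F" "f z \<notin> F" using z fF by (auto simp: Y_def E_def)
    then show ?thesis using \<theta>D[of i "f z"] \<theta>D[of j z] i j by simp
  qed
  have finK: "finite (saturation K)"
    unfolding saturation_def using K(1) inj_iter by (auto intro!: finite_vimageI)
  have "saturation K \<subseteq> saturation (ball s r)" using K(2) by (auto simp: saturation_def)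
  moreover have "open (saturation (ball s r))" unfolding saturation_def
    using cont_iter[of UNIV]
    by (intro open_UN ballI continuous_open_vimage open_ball) (simp add: continuous_on_eq_continuous_at)
  moreover have "saturation (ball s r) \<subseteq> saturation (cball s r)" by (auto simp: saturation_def)
  ultimately have "saturation K \<subseteq> interior (saturation (cball s r))" by (meson interior_maximal order_trans)
  then have Eint: "E \<subseteq> interior (Z \<union> saturation (cball s r))"
    using intF interior_mono[of Z "Z \<union> saturation (cball s r)"] interior_mono[of "saturation (cball s r)" "Z \<union> saturation (cball s r)"]
    unfolding E_def by blast
  have free: "(f ^^ k) a \<noteq> a" if a: "a \<in> E" and k: "0 < k" "k < p" for a k
  proof (cases "a \<in> F")
    case True then show ?thesis using freeF k by auto
  next
    case False
    then obtain j where j: "j < p" "(f ^^ j) a \<in> cball s r" using a K(2) by (auto simp: E_def saturation_def)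
    have "(f ^^ k) ((f ^^ j) a) \<noteq> (f ^^ j) a" using D j k unfolding moved_freely_def by metis
    then show ?thesis by (metis add.commute comp_apply funpow_add)
  qed
  have "closed (saturation (cball s r))" unfolding saturation_def using clo by (intro closed_UN) auto
  then have "closed (Z \<union> saturation (cball s r))" using cZ by (rule closed_Un[rotated])
  moreover have "finite E" using finF finK by (simp add: E_def)
  moreover have "f z \<in> Z \<union> saturation (cball s r) \<longleftrightarrow> z \<in> Z \<union> saturation (cball s r)" for z
    using fZ saturation_invariant by simp
  ultimately have "invariant_circle_map (Z \<union> saturation (cball s r)) E \<theta>"
    unfolding invariant_circle_map_def
    using fE Eint free contY im inv unfolding Y_def by blast
  moreover have "E \<inter> Z = F" using KZ FZ by (auto simp: E_def)
  ultimately show thesis using that[of E \<theta>] \<theta>Z by simp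
qed

lemma extend_over_free_cballs:
  assumes "finite T" "invariant_circle_map Z F \<psi>" "\<And>s r. (s, r) \<in> T \<Longrightarrow> moved_freely (cball s r)"
  shows "\<exists>F' \<psi>'. invariant_circle_map (Z \<union> (\<Union>(s,r)\<in>T. saturation (cball s r))) F' \<psi>' \<and>
    F' \<inter> Z = F \<and> (\<forall>z\<in>Z - F. \<psi>' z = \<psi> z)"
  using assms(1,3)
proof (induction T rule: finite_induct)
  case empty
  have "F \<subseteq> interior Z" using assms(2) by (simp add: invariant_circle_map_def)
  then have "F \<inter> Z = F" using interior_subset by auto
  then show ?case using assms(2) by auto
next
  case (insert x T)
  obtain s r where x: "x = (s, r)" by force
  define Y where "Y = Z \<union> (\<Union>(s,r)\<in>T. saturation (cball s r))"
  have "\<And>s r. (s, r) \<in> T \<Longrightarrow> moved_freely (cball s r)" using insert.prems by simp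
  from insert.IH[OF this] obtain E \<phi> where
    E: "invariant_circle_map Y E \<phi>" "E \<inter> Z = F" "\<And>z. z \<in> Z - F \<Longrightarrow> \<phi> z = \<psi> z"
    unfolding Y_def by auto
  have "moved_freely (cball s r)" using insert.prems x by simp
  from extend_over_free_cball[OF E(1) this] obtain F' \<psi>' where
    F': "invariant_circle_map (Y \<union> saturation (cball s r)) F' \<psi>'"
    "F' \<inter> Y = E" "\<And>z. z \<in> Y - E \<Longrightarrow> \<psi>' z = \<phi> z"
    by metis
  have "Y \<union> saturation (cball s r) = Z \<union> (\<Union>(s,r)\<in>insert x T. saturation (cball s r))"
    by (auto simp: Y_def x)
  moreover have "F' \<inter> Z = F" using F'(2) E(2) by (auto simp: Y_def)
  moreover have "\<psi>' z = \<psi> z" if "z \<in> Z - F" for z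
    using F'(3)[of z] E that by (auto simp: Y_def)
  ultimately show ?case using F'(1) by metis
qed

end

section \<open>The order divides the winding at infinity\<close>

context periodic_plane_map
begin

lemma small_cball_moved_freely:
  assumes "\<And>k. 0 < k \<Longrightarrow> k < p \<Longrightarrow> (f ^^ k) s \<noteq> s"
  obtains r where "0 < r" "moved_freely (cball s r)"
proof -
  have "\<forall>\<^sub>F r in at_right (0::real). \<forall>z\<in>cball s r. (f ^^ k) z \<notin> cball s r" if k: "k \<in> {0<..<p}" for k
  proof -
    define d where "d = dist ((f ^^ k) s) s"
    have d: "d > 0" using assms k by (auto simp: d_def)
    have "isCont (f ^^ k) s" using cont_iter[of UNIV k] by (simp add: continuous_on_eq_continuous_at)
    then obtain \<delta> where \<delta>: "\<delta> > 0" "\<And>z. dist z s < \<delta> \<Longrightarrow> dist ((f ^^ k) z) ((f ^^ k) s) < d/2"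
      using d unfolding continuous_at by (metis half_gt_zero dist_commute continuous_at_eps_delta \<open>isCont (f ^^ k) s\<close>)
    have "\<forall>z\<in>cball s r. (f ^^ k) z \<notin> cball s r" if r: "0 < r" "r < min \<delta> (d/2)" for r
    proof
      fix z assume "z \<in> cball s r"
      then have "dist ((f ^^ k) z) ((f ^^ k) s) < d/2" using \<delta>(2)[of z] r by (simp add: dist_commute)
      moreover have "d \<le> dist ((f ^^ k) s) ((f ^^ k) z) + dist ((f ^^ k) z) s" unfolding d_def by (rule dist_triangle)
      ultimately show "(f ^^ k) z \<notin> cball s r" using r by (simp add: dist_commute)
    qed
    moreover have "0 < min \<delta> (d/2)" using \<delta> d by simp
    ultimately show ?thesis unfolding eventually_at_right_field by blast
  qed
  then have "\<forall>\<^sub>F r in at_right (0::real). \<forall>k\<in>{0<..<p}. \<forall>z\<in>cball s r. (f ^^ k) z \<notin> cball s r"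
    by (intro eventually_ball_finite) auto
  then have "\<forall>\<^sub>F r in at_right (0::real). 0 < r \<and> moved_freely (cball s r)"
    using eventually_at_right_less[of "0::real"] by eventually_elim (auto simp: moved_freely_def)
  then show thesis using that eventually_happens'[of "at_right (0::real)"] by auto
qed

lemma iter_large:
  obtains R where "0 \<le> R" "\<And>k z. k \<le> p \<Longrightarrow> R < norm z \<Longrightarrow> C < norm ((f ^^ k) z)"
proof -
  define B where "B = (\<Union>k\<le>p. (f ^^ k) ` cball 0 C)"
  have "compact B" unfolding B_def
    by (intro compact_UN compact_continuous_image cont_iter) auto
  then obtain R where R: "\<And>z. z \<in> B \<Longrightarrow> norm z \<le> R" by (meson bounded_iff compact_imp_bounded)
  have "C < norm ((f ^^ k) z)" if k: "k \<le> p" and z: "\<bar>R\<bar> < norm z" for k z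
  proof (rule ccontr)
    assume "\<not> C < norm ((f ^^ k) z)"
    then have "(f ^^ (p - k)) ((f ^^ k) z) \<in> B" unfolding B_def by (intro UN_I[of "p - k"] imageI) auto
    then show False using R iter_inverse[OF k, of z] z by fastforce
  qed
  then show thesis by (intro that[of "\<bar>R\<bar>"]) auto
qed

lemma bounded_saturation: "bounded D \<Longrightarrow> bounded (saturation D)"
proof -
  assume "bounded D"
  then obtain C where C: "\<And>z. z \<in> D \<Longrightarrow> norm z \<le> C" by (auto simp: bounded_iff)
  obtain R where R: "\<And>k z. k \<le> p \<Longrightarrow> R < norm z \<Longrightarrow> C < norm ((f ^^ k) z)" using iter_large by metis
  have "norm z \<le> R" if "z \<in> saturation D" for z
    using that C R unfolding saturation_def by (force simp: not_less[symmetric])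
  then show ?thesis by (auto simp: bounded_iff)
qed

text \<open>
  The zero set of \<open>\<phi>\<close> may be any compact set. It is covered by finitely many freely moved discs; away
  from their translates the direction \<open>sgn \<circ> \<phi>\<close> is defined and invariant, and it is then extended over
  the discs.
\<close>

lemma remove_zeros_up_to_finite_set:
  assumes \<phi>: "continuous_on UNIV \<phi>" "\<And>z. \<phi> (f z) = \<phi> z"
    and S: "compact {z. \<phi> z = 0}"
    and free: "\<And>z k. \<phi> z = 0 \<Longrightarrow> 0 < k \<Longrightarrow> k < p \<Longrightarrow> (f ^^ k) z \<noteq> z"
  obtains F \<psi> R where "invariant_circle_map UNIV F \<psi>" "\<And>z. R < norm z \<Longrightarrow> \<psi> z = sgn (\<phi> z)"
proof -
  define S where "S = {z. \<phi> z = 0}"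
  have "\<exists>r>0. moved_freely (cball s r)" if "s \<in> S" for s
    using small_cball_moved_freely[of s] free that unfolding S_def by blast
  then obtain \<rho> where \<rho>: "\<And>s. s \<in> S \<Longrightarrow> 0 < \<rho> s \<and> moved_freely (cball s (\<rho> s))" by metis
  have "S \<subseteq> (\<Union>s\<in>S. ball s (\<rho> s))" using \<rho> by auto
  then obtain S' where S': "S' \<subseteq> S" "finite S'" "S \<subseteq> (\<Union>s\<in>S'. ball s (\<rho> s))"
    using S compactE_image[of S S "\<lambda>s. ball s (\<rho> s)"] unfolding S_def by blast
  define U where "U = (\<Union>s\<in>S'. saturation (ball s (\<rho> s)))"
  define Z where "Z = - U"
  have opensat: "open (saturation (ball s r))" for s r
    unfolding saturation_def using cont_iter[of UNIV]
    by (intro open_UN ballI continuous_open_vimage open_ball) (simp add: continuous_on_eq_continuous_at)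
  then have "open U" unfolding U_def by blast
  have "S \<subseteq> U" using S'(3) subset_saturation unfolding U_def by blast
  then have nzZ: "\<phi> z \<noteq> 0" if "z \<in> Z" for z using that by (auto simp: S_def Z_def)
  have "continuous_on Z (\<lambda>z. sgn (\<phi> z))"
    using nzZ \<phi>(1) by (intro continuous_on_sgn) (auto intro: continuous_on_subset)
  moreover have "(f z \<in> Z) = (z \<in> Z)" for z using saturation_invariant by (simp add: Z_def U_def)
  moreover have "closed Z" using \<open>open U\<close> by (simp add: Z_def closed_Compl)
  ultimately have "invariant_circle_map Z {} (\<lambda>z. sgn (\<phi> z))"
    using \<phi>(2) nzZ by (auto simp: invariant_circle_map_def norm_sgn)
  moreover have "finite ((\<lambda>s. (s, \<rho> s)) ` S')" using S'(2) by simp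
  moreover have "moved_freely (cball s r)" if "(s, r) \<in> (\<lambda>s. (s, \<rho> s)) ` S'" for s r
    using that \<rho> S'(1) by auto
  ultimately obtain F \<psi> where
    F: "invariant_circle_map (Z \<union> (\<Union>(s,r)\<in>(\<lambda>s. (s, \<rho> s)) ` S'. saturation (cball s r))) F \<psi>"
      "F \<inter> Z = {}" "\<And>z. z \<in> Z \<Longrightarrow> \<psi> z = sgn (\<phi> z)"
    using extend_over_free_cballs[of "(\<lambda>s. (s, \<rho> s)) ` S'" Z "{}" "\<lambda>z. sgn (\<phi> z)"] by (metis Diff_empty)
  have "saturation (ball s r) \<subseteq> saturation (cball s r)" for s r by (auto simp: saturation_def)
  then have "U \<subseteq> (\<Union>(s,r)\<in>(\<lambda>s. (s, \<rho> s)) ` S'. saturation (cball s r))" by (auto simp: U_def)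
  then have univ: "Z \<union> (\<Union>(s,r)\<in>(\<lambda>s. (s, \<rho> s)) ` S'. saturation (cball s r)) = UNIV"
    by (auto simp: Z_def)
  have "bounded U" unfolding U_def using S' by (intro bounded_UN ballI bounded_saturation) auto
  then obtain R where "\<And>z. z \<in> U \<Longrightarrow> norm z \<le> R" by (auto simp: bounded_iff)
  then have "z \<in> Z" if "R < norm z" for z using that by (force simp: Z_def)
  then show thesis using that[of F \<psi> R] F univ by auto
qed

lemma order_dvd_sum_over_free_orbits:
  assumes "finite F" "\<And>z. f z \<in> F \<longleftrightarrow> z \<in> F"
    and "\<And>a k. a \<in> F \<Longrightarrow> 0 < k \<Longrightarrow> k < p \<Longrightarrow> (f ^^ k) a \<noteq> a"
    and "\<And>a. a \<in> F \<Longrightarrow> n (f a) = (n a :: int)"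
  shows "int p dvd (\<Sum>a\<in>F. n a)"
  using assms
proof (induction F rule: finite_psubset_induct)
  case (psubset F)
  show ?case
  proof (cases "F = {}")
    case False
    then obtain a where a: "a \<in> F" by auto
    define Orb where "Orb = (\<lambda>k. (f ^^ k) a) ` {..<p}"
    have itF: "(f ^^ k) z \<in> F \<longleftrightarrow> z \<in> F" for k z using psubset.prems(1) by (rule invariant_iter)
    have OF: "Orb \<subseteq> F" using a itF by (auto simp: Orb_def)
    have "a \<in> Orb" using p_pos by (force simp: Orb_def)
    have fO: "f z \<in> Orb \<longleftrightarrow> z \<in> Orb" for z
    proof
      assume "z \<in> Orb"
      then obtain k where "z = (f ^^ k) a" by (auto simp: Orb_def)
      then have "f z = (f ^^ (Suc k mod p)) a" by (simp add: iter_mod)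
      then show "f z \<in> Orb" using p_pos by (auto simp: Orb_def)
    next
      assume "f z \<in> Orb"
      then obtain k where "f z = (f ^^ k) a" by (auto simp: Orb_def)
      moreover have "z = (f ^^ (p - 1)) (f z)" using iter_inverse[of 1 z] p_pos by simp
      ultimately have "z = (f ^^ ((p - 1 + k) mod p)) a" by (simp add: iter_mod funpow_add)
      then show "z \<in> Orb" using p_pos unfolding Orb_def by (meson imageI lessThan_iff mod_less_divisor)
    qed
    have "inj_on (\<lambda>k. (f ^^ k) a) {..<p}"
    proof (rule inj_onI)
      fix i j assume ij: "i \<in> {..<p}" "j \<in> {..<p}" "(f ^^ i) a = (f ^^ j) a"
      have "moved_freely {(f ^^ i) a}"
        using psubset.prems(2)[of "(f ^^ i) a"] itF a by (auto simp: moved_freely_def)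
      then show "i = j" using moved_freely_unique[of "{(f ^^ i) a}" i j a] ij by auto
    qed
    moreover have "n ((f ^^ k) a) = n a" for k
      by (induction k) (use psubset.prems(3) itF a in auto)
    ultimately have "(\<Sum>z\<in>Orb. n z) = int p * n a"
      by (simp add: Orb_def sum.reindex)
    moreover have "int p dvd (\<Sum>z\<in>F - Orb. n z)"
      using \<open>a \<in> Orb\<close> a psubset.prems fO by (intro psubset.IH) auto
    moreover have "(\<Sum>z\<in>F. n z) = (\<Sum>z\<in>F - Orb. n z) + (\<Sum>z\<in>Orb. n z)"
      using OF psubset.hyps by (intro sum.subset_diff) auto
    ultimately show ?thesis by simp
  qed simp
qed

text \<open>
  By invariance of \<open>\<psi>\<close> and the orientation hypothesis on \<open>f\<close>, the winding of \<open>\<psi>\<close> is the same at \<open>a\<close> and at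
  \<open>f a\<close>. The local windings thus sum to a multiple of \<open>p\<close>, because every orbit in \<open>F\<close> has \<open>p\<close> elements.
\<close>

lemma order_dvd_wraps_at_infinity:
  assumes \<psi>: "invariant_circle_map UNIV F \<psi>"
    and f: "\<And>a. wraps (\<lambda>z. f z - f a) a 1 (- {a})"
    and m: "wraps \<psi> 0 m {z. R < norm z}"
  shows "int p dvd m"
proof -
  have finF: "finite F" and fF: "\<And>z. f z \<in> F \<longleftrightarrow> z \<in> F"
    and freeF: "\<And>a k. a \<in> F \<Longrightarrow> 0 < k \<Longrightarrow> k < p \<Longrightarrow> (f ^^ k) a \<noteq> a"
    and cont\<psi>: "continuous_on (- F) \<psi>" and "\<And>z. z \<notin> F \<Longrightarrow> norm (\<psi> z) = 1"
    and inv\<psi>: "\<And>z. z \<notin> F \<Longrightarrow> \<psi> (f z) = \<psi> z"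
    using \<psi> unfolding invariant_circle_map_def by (auto simp: Compl_eq_Diff_UNIV image_subset_iff)
  then have im\<psi>: "\<psi> z \<noteq> 0" if "z \<notin> F" for z using that by force
  obtain \<rho> where \<rho>: "0 < \<rho>" "\<And>a b. a \<in> F \<Longrightarrow> b \<in> F \<Longrightarrow> a \<noteq> b \<Longrightarrow> 2 * \<rho> \<le> dist a b"
  proof -
    define D where "D = insert 1 {dist a b | a b. a \<in> F \<and> b \<in> F \<and> a \<noteq> b}"
    have "D \<subseteq> insert 1 ((\<lambda>(a,b). dist a b) ` (F \<times> F))" by (auto simp: D_def)
    then have "finite D" using finF finite_subset by blast
    moreover have "\<forall>x\<in>D. 0 < x" by (auto simp: D_def)
    ultimately have "0 < Min D" "\<And>x. x \<in> D \<Longrightarrow> Min D \<le> x" by (auto simp: D_def)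
    then show thesis by (intro that[of "Min D / 2"]) (auto simp: D_def)
  qed
  have avoid: "z \<notin> F" if "a \<in> F" "z \<in> annulus a {0<..<\<rho>}" for a z
    using \<rho>(2)[OF that(1), of z] that \<rho>(1) by (force simp: annulus_def)
  have "\<exists>n. wraps \<psi> a n (annulus a {0<..<\<rho>})" if "a \<in> F" for a
  proof -
    have "continuous_on (annulus a {0<..<\<rho>}) \<psi>"
      using cont\<psi> by (rule continuous_on_subset) (use avoid[OF that] in auto)
    then show ?thesis using im\<psi> avoid[OF that] wraps_exists[of "{0<..<\<rho>}" a \<psi>]
      by (metis greaterThanLessThan_iff greaterThan_iff is_interval_oo subsetI)
  qed
  then obtain n where n: "\<And>a. a \<in> F \<Longrightarrow> wraps \<psi> a (n a) (annulus a {0<..<\<rho>})" by metis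
  have "n (f a) = n a" if a: "a \<in> F" for a
  proof -
    have "isCont f a" using cont by (simp add: continuous_on_eq_continuous_at)
    then obtain \<delta> where \<delta>: "\<delta> > 0" "\<And>z. dist z a < \<delta> \<Longrightarrow> dist (f z) (f a) < \<rho>"
      using \<rho>(1) by (metis continuous_at_eps_delta)
    define A where "A = annulus a {0<..<min \<delta> \<rho>}"
    have "f ` A \<subseteq> annulus (f a) {0<..<\<rho>}"
      using \<delta>(2) inj_f by (auto simp: A_def annulus_def dist_commute inj_eq)
    moreover have "wraps (\<lambda>z. f z - f a) a 1 A" using f by (rule wraps_subset) (auto simp: A_def annulus_def)
    ultimately have "wraps (\<lambda>z. \<psi> (f z)) a (1 * n (f a)) A"
      using wraps_compose[OF n[of "f a"], where f = f and A = A and a = a and m = 1]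
        a fF continuous_on_subset[OF cont] by auto
    then have "wraps \<psi> a (n (f a)) A"
      using inv\<psi> avoid[OF a] by (subst wraps_cong[where k = "\<lambda>z. \<psi> (f z)"]) (auto simp: A_def annulus_def)
    moreover have "wraps \<psi> a (n a) A" using n[OF a] by (rule wraps_subset) (auto simp: A_def annulus_def)
    moreover have "sphere a (min \<delta> \<rho> / 2) \<subseteq> A" using \<delta> \<rho> by (auto simp: A_def annulus_def)
    ultimately show ?thesis using wraps_unique[of \<psi> a "n (f a)" A "n a" "min \<delta> \<rho> / 2"] \<delta> \<rho> by auto
  qed
  then have "int p dvd (\<Sum>a\<in>F. n a)"
    using finF fF freeF by (intro order_dvd_sum_over_free_orbits) auto
  moreover have "m = (\<Sum>a\<in>F. n a)"
    using finF cont\<psi> im\<psi> \<rho> n m by (intro wraps_at_infinity_eq_sum[where \<psi> = \<psi> and \<rho> = \<rho> and R = R]) auto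
  ultimately show ?thesis by simp
qed

end

section \<open>Periodic plane homeomorphisms with two fixed points\<close>

context periodic_plane_map
begin

text \<open>
  Primality makes every power of \<open>f\<close> with exponent between \<open>0\<close> and \<open>p\<close> a generator of the group
  generated by \<open>f\<close>. So a point moved by \<open>f\<close> has an orbit with exactly \<open>p\<close> elements.
\<close>

lemma fixed_point_of_iter:
  assumes "prime p" "0 < k" "k < p" "(f ^^ k) z = z"
  shows "f z = z"
proof -
  have "coprime k p" using assms(1-3) by (metis coprime_commute nat_dvd_not_less prime_imp_coprime)
  then obtain i where "[k * i = 1] (mod p)" using cong_solve_coprime_nat by auto
  moreover have "1 < p" using assms(1) prime_gt_1_nat by blast
  ultimately have "(k * i) mod p = 1" by (simp add: cong_def)
  then have "f z = (f ^^ (k * i)) z" using iter_mod[of "k * i" z] by simp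
  also have "\<dots> = (((f ^^ k) ^^ i) z)" by (simp add: funpow_mult)
  also have "\<dots> = z" by (induction i) (use assms in auto)
  finally show ?thesis .
qed

text \<open>
  Seen from infinity, \<open>z - a\<close> and \<open>f z - f a\<close> have the same direction as \<open>z\<close> and \<open>f z\<close>, up to a small
  error. Hence the exponent does not depend on \<open>a\<close>.
\<close>

lemma wraps_about_every_point:
  assumes "wraps f 0 1 (- {0})" "f 0 = 0"
  shows "wraps (\<lambda>z. f z - f a) a 1 (- {a})"
proof -
  have ann: "- {a} = annulus a {0<..}" by (auto simp: annulus_def)
  have "continuous_on (annulus a {0<..}) (\<lambda>z. f z - f a)"
    using cont by (intro continuous_intros) (rule continuous_on_subset, auto)
  moreover have "f z - f a \<noteq> 0" if "z \<in> annulus a {0<..}" for z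
    using that inj_f ann by (auto simp: inj_eq)
  ultimately obtain n where n: "wraps (\<lambda>z. f z - f a) a n (- {a})"
    using wraps_exists[of "{0<..}" a "\<lambda>z. f z - f a"] unfolding ann by (metis is_interval_oi order_refl)
  obtain R where R: "0 \<le> R" "\<And>k z. k \<le> p \<Longrightarrow> R < norm z \<Longrightarrow> norm (f a) < norm ((f ^^ k) z)"
    using iter_large[where C = "norm (f a)"] by metis
  define R' where "R' = max R (norm a)"
  define A where "A = {z::complex. R' < norm z}"
  have "wraps (\<lambda>z. f z - f a) 0 1 A"
  proof (rule wraps_perturb)
    show "wraps f 0 1 A" using assms(1) by (rule wraps_subset) (use R in \<open>auto simp: A_def R'_def\<close>)
    show "norm (f z - f a - f z) < norm (f z)" if "z \<in> A" for z
      using R(2)[of 1 z] p_pos that by (auto simp: A_def R'_def)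
  qed (use cont in \<open>auto intro!: continuous_intros intro: continuous_on_subset\<close>)
  moreover have "wraps (\<lambda>z. f z - f a) 0 n A"
  proof -
    obtain L where L: "continuous_on (- {a}) L" "\<And>z. z \<in> - {a} \<Longrightarrow> f z - f a = (z - a) powi n * exp (L z)"
      using n unfolding wraps_def by auto
    have aA: "A \<subseteq> - {a}" by (auto simp: A_def R'_def)
    have "wraps (\<lambda>z. (z - a) powi n) 0 (1 * n) A"
      unfolding A_def by (intro wraps_powi wraps_translate_at_infinity) (simp add: R'_def)
    moreover have "wraps (\<lambda>z. exp (L z)) 0 0 A"
      unfolding wraps_def using continuous_on_subset[OF L(1) aA] by auto
    ultimately have "wraps (\<lambda>z. (z - a) powi n * exp (L z)) 0 (1 * n + 0) A"
      using R(1) by (intro wraps_mult) (auto simp: A_def R'_def)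
    moreover have "f z - f a = (z - a) powi n * exp (L z)" if "z \<in> A" for z using L(2) aA that by blast
    ultimately show ?thesis
      by (subst wraps_cong[where k = "\<lambda>z. (z - a) powi n * exp (L z)"]) (assumption, simp)
  qed
  moreover have "sphere 0 (R' + 1) \<subseteq> A" by (auto simp: A_def)
  moreover have "0 < R' + 1" using R(1) by (simp add: R'_def)
  ultimately have "n = 1" using wraps_unique by blast
  then show ?thesis using n by simp
qed

text \<open>
  \<open>K\<close> is the geometric mean of the orbit, that is, a \<open>p\<close>-th root of the product of its points. The root is
  chosen consistently by means of the logarithms of \<open>(f ^^ i) z / z\<close>. The fixed point \<open>b\<close> is what makes
  \<open>K\<close> invariant: it forces the logarithm that belongs to \<open>f ^^ p\<close> to be \<open>0\<close> and not merely a multiple of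
  \<open>2 * pi * \<i>\<close>. (A rotation of order \<open>p\<close> about \<open>0\<close> has no second fixed point, and there the mean of the
  logarithms is not invariant.)
\<close>

lemma invariant_proper_map_exists:
  assumes w: "wraps f 0 1 (- {0})" and f0: "f 0 = 0" and b: "b \<noteq> 0" "f b = b"
  obtains K where "continuous_on UNIV K" "\<And>z. K (f z) = K z" "\<And>z. f z = z \<Longrightarrow> K z = z"
    "wraps K 0 1 (- {0})" "\<And>z. K z ^ p = (\<Prod>i<p. (f ^^ i) z)"
proof -
  obtain l0 where l0: "continuous_on (- {0}) l0" "\<And>z. z \<noteq> 0 \<Longrightarrow> f z = z * exp (l0 z)"
    using w unfolding wraps_def by auto
  define l where "l z = l0 z - l0 b" for z
  have "exp (l0 b) = 1" using l0(2)[OF b(1)] b by simp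
  then have fl: "f z = z * exp (l z)" if "z \<noteq> 0" for z using l0(2)[OF that] by (simp add: l_def exp_diff)
  have contl: "continuous_on (- {0}) l" unfolding l_def by (intro continuous_intros l0)
  have lb: "l b = 0" by (simp add: l_def)
  have it0: "(f ^^ k) z = 0 \<longleftrightarrow> z = 0" for k z
    using invariant_iter[of "{0}" k z] inj_f f0 by (metis inj_eq singleton_iff)
  define L where "L i z = (\<Sum>k<i. l ((f ^^ k) z))" for i z
  have fL: "(f ^^ i) z = z * exp (L i z)" if z: "z \<noteq> 0" for i z
  proof (induction i)
    case (Suc i)
    then show ?case using fl[of "(f ^^ i) z"] it0 z by (simp add: L_def exp_add)
  qed (simp add: L_def)
  have contL: "continuous_on (- {0}) (L i)" for i
    unfolding L_def using it0 by (intro continuous_on_sum continuous_on_compose2[OF contl cont_iter]) auto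
  have "L p constant_on (- {0})"
  proof (rule exp_eq_1_imp_constant_on)
    show "connected (- {0::complex})" by (rule connected_punctured_universe) simp
    show "exp (L p z) = 1" if "z \<in> - {0}" for z using fL[of z p] per[of z] that by simp
  qed (rule contL)
  moreover have "(f ^^ k) b = b" for k by (induction k) (use b in auto)
  then have "L p b = 0" by (simp add: L_def lb)
  ultimately have Lp: "L p z = 0" if "z \<noteq> 0" for z using b(1) that unfolding constant_on_def by auto
  define K where "K z = z * exp ((\<Sum>i<p. L i z) / of_nat p)" for z
  have Kpow: "K z ^ p = (\<Prod>i<p. (f ^^ i) z)" for z
  proof (cases "z = 0")
    case True
    then show ?thesis using p_pos it0[of _ 0] by (auto simp: K_def)
  next
    case False
    have "K z ^ p = z ^ p * exp (of_nat p * ((\<Sum>i<p. L i z) / of_nat p))"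
      by (simp only: K_def power_mult_distrib exp_of_nat_mult)
    also have "\<dots> = z ^ p * (\<Prod>i<p. exp (L i z))" using p_pos by (simp add: exp_sum)
    also have "\<dots> = (\<Prod>i<p. z * exp (L i z))" by (simp add: prod.distrib)
    finally show ?thesis using False by (simp add: fL)
  qed
  have contK0: "continuous_on (- {0}) (\<lambda>z. (\<Sum>i<p. L i z) / of_nat p)"
    using p_pos by (intro continuous_intros contL) auto
  then have wK: "wraps K 0 1 (- {0})" unfolding wraps_def K_def by auto
  have "isCont K z" for z
  proof (cases "z = 0")
    case False
    have "continuous_on (- {0}) K" unfolding K_def by (intro continuous_intros contK0)
    then show ?thesis using False by (simp add: continuous_on_eq_continuous_at open_Compl)
  next
    case True
    have "((\<lambda>z. norm (\<Prod>i<p. (f ^^ i) z)) \<longlongrightarrow> norm (\<Prod>i<p. (f ^^ i) 0)) (at 0)"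
      using cont_iter[of UNIV] by (intro tendsto_intros) (simp add: continuous_on_eq_continuous_at isCont_def)
    moreover have "norm (\<Prod>i<p. (f ^^ i) 0) = 0" using p_pos it0[of _ 0] by auto
    moreover have "norm (\<Prod>i<p. (f ^^ i) z) = norm (K z) ^ p" for z by (simp add: norm_power flip: Kpow)
    ultimately have lim: "((\<lambda>z. norm (K z) ^ p) \<longlongrightarrow> 0) (at 0)" by (simp only:)
    have "(K \<longlongrightarrow> 0) (at 0)"
    proof (rule tendstoI)
      fix e :: real assume "0 < e"
      then have "\<forall>\<^sub>F z in at 0. norm (K z) ^ p < e ^ p" using lim by (intro order_tendstoD(2)) auto
      then show "\<forall>\<^sub>F z in at 0. dist (K z) 0 < e"
        by eventually_elim (use \<open>0 < e\<close> power_less_imp_less_base in force)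
    qed
    then show ?thesis using True by (simp add: isCont_def K_def)
  qed
  then have contK: "continuous_on UNIV K" by (simp add: continuous_on_eq_continuous_at)
  have Kf: "K (f z) = K z" for z
  proof (cases "z = 0")
    case False
    have "L i (f z) = L (Suc i) z - l z" for i
      by (simp add: L_def sum.lessThan_Suc_shift funpow_swap1 del: sum.lessThan_Suc)
    then have "(\<Sum>i<p. L i (f z)) = (\<Sum>i<p. L (Suc i) z) - of_nat p * l z"
      by (simp add: sum_subtractf)
    also have "(\<Sum>i<p. L (Suc i) z) = (\<Sum>i<p. L i z) + L p z - L 0 z"
      using sum.lessThan_Suc_shift[of "\<lambda>i. L i z" p] by simp
    finally have "(\<Sum>i<p. L i (f z)) / of_nat p = (\<Sum>i<p. L i z) / of_nat p - l z"
      using Lp[OF False] p_pos by (simp add: L_def field_simps)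
    then show ?thesis using fl[OF False] by (simp add: K_def exp_diff)
  qed (simp add: f0)
  have "K z = z" if "f z = z" for z
  proof (cases "z = 0")
    case False
    have "(f ^^ k) z = z" for k by (induction k) (use that in auto)
    then have "L i z = of_nat i * l z" for i by (simp add: L_def)
    moreover from this have "l z = 0" using Lp[OF False] p_pos by auto
    ultimately show ?thesis by (simp add: K_def)
  qed (simp add: K_def)
  then show thesis using that[OF contK Kf _ wK Kpow] by blast
qed

text \<open>
  If \<open>f\<close> moved \<open>y\<close>, then the fibre of \<open>K\<close> over \<open>y\<close> would consist of free orbits, as \<open>K\<close> is the identity on
  fixed points. So \<open>p\<close> would divide the winding of \<open>K - y\<close> at infinity, which is \<open>1\<close>.
\<close>

lemma prime_order_fixing_two_points_trivial:
  assumes w: "wraps f 0 1 (- {0})" and f0: "f 0 = 0" and b: "b \<noteq> 0" "f b = b" and "prime p"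
  shows "f y = y"
proof (rule ccontr)
  assume y: "f y \<noteq> y"
  obtain K where K: "continuous_on UNIV K" "\<And>z. K (f z) = K z" "\<And>z. f z = z \<Longrightarrow> K z = z"
    "wraps K 0 1 (- {0})" and Kpow: "\<And>z. K z ^ p = (\<Prod>i<p. (f ^^ i) z)"
    using invariant_proper_map_exists[OF w f0 b] by metis
  obtain R where R: "0 \<le> R" "\<And>k z. k \<le> p \<Longrightarrow> R < norm z \<Longrightarrow> norm y + 1 < norm ((f ^^ k) z)"
    using iter_large[where C = "norm y + 1"] by metis
  (* K ^ p is the product of the points of an orbit, all of which are large if one of them is. *)
  have Kbig: "norm y < norm (K z)" if z: "R < norm z" for z
  proof -
    have "(norm y + 1) ^ p = (\<Prod>i<p. norm y + 1)" by simp
    also have "\<dots> \<le> (\<Prod>i<p. norm ((f ^^ i) z))"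
      using R(2)[OF _ z] by (intro prod_mono) (auto simp: less_imp_le)
    also have "\<dots> = norm (K z) ^ p" by (simp add: prod_norm flip: Kpow norm_power)
    finally have "norm y + 1 \<le> norm (K z)"
      using p_pos power_mono_iff[of "norm y + 1" "norm (K z)" p] by simp
    then show ?thesis by simp
  qed
  define \<phi> where "\<phi> z = K z - y" for z
  have cont\<phi>: "continuous_on UNIV \<phi>" unfolding \<phi>_def by (intro continuous_intros K)
  have "compact {z. \<phi> z = 0}"
  proof -
    have "{z. \<phi> z = 0} \<subseteq> cball 0 R" using Kbig by (force simp: \<phi>_def not_less[symmetric])
    moreover have "closed {z. \<phi> z = 0}" using cont\<phi> by (intro closed_Collect_eq) (auto intro: continuous_intros)
    ultimately show ?thesis using bounded_cball bounded_subset compact_eq_bounded_closed by blast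
  qed
  moreover have "\<phi> (f z) = \<phi> z" for z by (simp add: \<phi>_def K)
  moreover have "(f ^^ k) z \<noteq> z" if z: "\<phi> z = 0" and k: "0 < k" "k < p" for z k
  proof
    assume "(f ^^ k) z = z"
    then have "f z = z" using fixed_point_of_iter \<open>prime p\<close> k by blast
    then show False using K(3)[of z] z y by (simp add: \<phi>_def)
  qed
  ultimately obtain F \<psi> R' where \<psi>: "invariant_circle_map UNIV F \<psi>" "\<And>z. R' < norm z \<Longrightarrow> \<psi> z = sgn (\<phi> z)"
    using remove_zeros_up_to_finite_set[OF cont\<phi>] by metis
  define A where "A = {z::complex. max R R' < norm z}"
  have w\<phi>: "wraps \<phi> 0 1 A"
  proof (rule wraps_perturb)
    show "wraps K 0 1 A" using K(4) by (rule wraps_subset) (use R in \<open>auto simp: A_def\<close>)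
    show "norm (\<phi> z - K z) < norm (K z)" if "z \<in> A" for z using Kbig that by (auto simp: \<phi>_def A_def)
  qed (use K(1) cont\<phi> in \<open>auto intro: continuous_on_subset\<close>)
  have nz: "\<phi> z \<noteq> 0" if "z \<in> A" for z using Kbig[of z] that by (auto simp: \<phi>_def A_def)
  have "wraps (\<lambda>z. of_real (1 / norm (\<phi> z))) 0 0 A"
  proof -
    have "continuous_on A (\<lambda>z. of_real (- ln (norm (\<phi> z))) :: complex)"
      using cont\<phi> nz by (intro continuous_intros) (auto intro: continuous_on_subset)
    moreover have "of_real (1 / norm (\<phi> z)) = exp (of_real (- ln (norm (\<phi> z))) :: complex)" if "z \<in> A" for z
    proof -
      have "exp (- ln (norm (\<phi> z))) = 1 / norm (\<phi> z)"
        using nz[OF that] by (simp add: exp_minus inverse_eq_divide)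
      then show ?thesis by (metis exp_of_real)
    qed
    ultimately show ?thesis unfolding wraps_def
      by (intro exI[of _ "\<lambda>z. of_real (- ln (norm (\<phi> z)))"]) simp
  qed
  from wraps_mult[OF _ w\<phi> this] have "wraps (\<lambda>z. \<phi> z * of_real (1 / norm (\<phi> z))) 0 1 A"
    using R by (simp add: A_def)
  moreover have "\<psi> z = \<phi> z * of_real (1 / norm (\<phi> z))" if "z \<in> A" for z
    using that by (simp add: A_def \<psi>(2) sgn_div_norm scaleR_conv_of_real inverse_eq_divide)
  ultimately have "wraps \<psi> 0 1 {z. max R R' < norm z}"
    unfolding A_def[symmetric] by (subst wraps_cong) assumption+
  from order_dvd_wraps_at_infinity[OF \<psi>(1) wraps_about_every_point[OF w f0] this]
  have "p dvd 1" by (metis int_dvd_int_iff of_nat_1)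
  then show False using \<open>prime p\<close> by (simp add: prime_nat_iff)
qed

end

lemma wraps_iter:
  assumes "wraps f 0 1 (- {0})" "continuous_on UNIV f" "\<And>z. f z = 0 \<longleftrightarrow> z = 0"
  shows "wraps (f ^^ k) 0 1 (- {0})"
proof (induction k)
  case 0
  show ?case unfolding wraps_def by (intro exI[of _ "\<lambda>z. 0"]) auto
next
  case (Suc k)
  have "wraps (\<lambda>z. (f ^^ k) (f z)) 0 (1 * 1) (- {0})"
    using assms continuous_on_subset[OF assms(2)] by (intro wraps_compose[OF Suc]) auto
  then show ?case by (simp add: funpow_Suc_right o_def del: funpow.simps)
qed

text \<open>
  A nontrivial element of finite order has a power of prime order, to which the previous lemma applies.
\<close>

theorem periodic_fixing_two_points_trivial:
  assumes w: "wraps f 0 1 (- {0})" and cont: "continuous_on UNIV f"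
    and f0: "f 0 = 0" and b: "b \<noteq> 0" "f b = b"
    and n: "0 < n" "\<And>z. (f ^^ n) z = z"
  shows "f z = z"
  using n
proof (induction n arbitrary: z rule: less_induct)
  case (less n)
  show ?case
  proof (cases "n = 1")
    case True
    then show ?thesis using less.prems(2)[of z] by simp
  next
    case False
    then obtain q where q: "prime q" "q dvd n" using prime_factor_nat by blast
    then obtain m where m: "n = m * q" by (metis dvd_def mult.commute)
    then have "0 < m" using less.prems by auto
    interpret f: periodic_plane_map f n using less.prems cont by unfold_locales auto
    interpret g: periodic_plane_map "f ^^ m" q
      using q(1) prime_gt_0_nat f.cont_iter less.prems(2) by unfold_locales (auto simp: funpow_mult m)
    have "f z = 0 \<longleftrightarrow> z = 0" for z using f.inj_f f0 by (metis inj_eq)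
    then have "wraps (f ^^ m) 0 1 (- {0})" using w cont by (intro wraps_iter)
    moreover have "(f ^^ m) 0 = 0" by (induction m) (auto simp: f0)
    moreover have "(f ^^ m) b = b" by (induction m) (auto simp: b)
    ultimately have "(f ^^ m) z = z" for z
      using g.prime_order_fixing_two_points_trivial[OF _ _ b(1) _ q(1)] by blast
    moreover have "m < n" using m q(1) prime_gt_1_nat[of q] \<open>0 < m\<close> by simp
    ultimately show ?thesis using less.IH[of m z] \<open>0 < m\<close> by blast
  qed
qed

lemma periodic_fixing_two_points_trivial_translated:
  assumes w: "wraps (\<lambda>z. F z - a) a 1 (- {a})" and cont: "continuous_on UNIV F"
    and a: "F a = a" and b: "b \<noteq> a" "F b = b"
    and n: "0 < n" "\<And>z. (F ^^ n) z = z"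
  shows "F z = z"
proof -
  define f where "f z = F (z + a) - a" for z
  have it: "(f ^^ k) z = (F ^^ k) (z + a) - a" for k z by (induction k) (auto simp: f_def)
  obtain L where L: "continuous_on (- {a}) L" "\<And>z. z \<noteq> a \<Longrightarrow> F z - a = (z - a) powi 1 * exp (L z)"
    using w unfolding wraps_def by auto
  have "continuous_on (- {0}) (\<lambda>z. L (z + a))"
    by (intro continuous_on_compose2[OF L(1)] continuous_intros) auto
  moreover have "f z = (z - 0) powi 1 * exp (L (z + a))" if "z \<noteq> 0" for z
    using L(2)[of "z + a"] that by (simp add: f_def)
  ultimately have "wraps f 0 1 (- {0})" unfolding wraps_def by auto
  moreover have "continuous_on UNIV f"
    unfolding f_def by (intro continuous_intros continuous_on_compose2[OF cont]) auto
  ultimately have "f (z - a) = z - a"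
    by (rule periodic_fixing_two_points_trivial[where b = "b - a" and n = n])
      (use a b n it in \<open>auto simp: f_def\<close>)
  then show ?thesis by (simp add: f_def)
qed

text \<open>
  The exponents of \<open>f\<close> and of its inverse multiply to \<open>1\<close>.
\<close>

lemma homeomorphism_wraps:
  assumes "continuous_on UNIV f" "continuous_on UNIV g" "\<And>z. g (f z) = z" "\<And>z. f (g z) = z" "f a = a"
  shows "wraps (\<lambda>z. f z - a) a 1 (- {a}) \<or> wraps (\<lambda>z. f z - a) a (- 1) (- {a})"
proof -
  have ga: "g a = a" using assms(3)[of a] assms(5) by simp
  have ex: "\<exists>n. wraps (\<lambda>z. h z - a) a n (- {a})" if "continuous_on UNIV h" "\<And>z. h z = a \<longleftrightarrow> z = a" for h
  proof -
    have ann: "- {a} = annulus a {0<..}" by (auto simp: annulus_def)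
    have "continuous_on (annulus a {0<..}) (\<lambda>z. h z - a)"
      using that(1) by (intro continuous_intros) (rule continuous_on_subset, auto)
    then show ?thesis using wraps_exists[of "{0<..}" a "\<lambda>z. h z - a"] that(2)
      unfolding ann by (metis ComplD ann insertI1 is_interval_oi order_refl right_minus_eq)
  qed
  have fa: "f z = a \<longleftrightarrow> z = a" "g z = a \<longleftrightarrow> z = a" for z using assms ga by metis+
  obtain n m where n: "wraps (\<lambda>z. f z - a) a n (- {a})" and m: "wraps (\<lambda>z. g z - a) a m (- {a})"
    using ex[OF assms(1)] ex[OF assms(2)] fa by blast
  have "wraps (\<lambda>z. g (f z) - a) a (n * m) (- {a})"
    by (rule wraps_compose[OF m _ _ n]) (use fa continuous_on_subset[OF assms(1)] in auto)
  then have "wraps (\<lambda>z. z - a) a (n * m) (- {a})" by (simp add: assms(3))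
  moreover have "wraps (\<lambda>z. z - a) a 1 (- {a})" unfolding wraps_def by (intro exI[of _ "\<lambda>z. 0"]) auto
  moreover have "sphere a 1 \<subseteq> - {a}" by auto
  ultimately have "n * m = 1" using wraps_unique zero_less_one by blast
  then have "n = 1 \<or> n = - 1" by (metis zmult_eq_1_iff)
  then show ?thesis using n by auto
qed

section \<open>Orientation on the sphere in a stereographic chart\<close>

definition S2 :: "(nat \<Rightarrow> real) set" where
  "S2 = {x. (\<Sum>i\<le>2. x i ^ 2) = 1 \<and> (\<forall>i>2. x i = 0)}"

definition north :: "nat \<Rightarrow> real" where
  "north i = (if i = 2 then 1 else 0)"

text \<open>
  The first coordinate of the sphere becomes the imaginary part. Complex conjugation then corresponds
  to the reflection in that coordinate, which is the reflection whose degree is known.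
\<close>

definition stereo :: "(nat \<Rightarrow> real) \<Rightarrow> complex" where
  "stereo x = Complex (x 1 / (1 - x 2)) (x 0 / (1 - x 2))"

definition unstereo :: "complex \<Rightarrow> nat \<Rightarrow> real" where
  "unstereo z i = (if i = 0 then 2 * Im z / ((norm z)\<^sup>2 + 1) else if i = 1 then 2 * Re z / ((norm z)\<^sup>2 + 1)
     else if i = 2 then ((norm z)\<^sup>2 - 1) / ((norm z)\<^sup>2 + 1) else 0)"

lemma nsphere_2: "nsphere 2 = top_of_set S2"
  by (simp add: nsphere S2_def euclidean_product_topology)

lemma S2_iff: "x \<in> S2 \<longleftrightarrow> (x 0)\<^sup>2 + (x 1)\<^sup>2 + (x 2)\<^sup>2 = 1 \<and> (\<forall>i>2. x i = 0)"
  by (simp add: S2_def numeral_2_eq_2)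

lemma norm_sq_plus_1_pos: "(norm (z::complex))\<^sup>2 + 1 > 0"
  by (simp add: add_nonneg_pos)

lemma north_in_S2: "north \<in> S2"
  by (simp add: S2_iff north_def)

lemma S2_eq_north_iff: "x \<in> S2 \<Longrightarrow> x = north \<longleftrightarrow> x 2 = 1"
proof
  assume x: "x \<in> S2" "x 2 = 1"
  then have "x 0 = 0" "x 1 = 0" by (auto simp: S2_iff sum_power2_eq_zero_iff)
  moreover have "x i = 0" if "i > 2" for i using x that by (simp add: S2_iff)
  ultimately have "x i = north i" for i
    using x(2) by (cases "i > 2"; cases "i = 2"; cases "i = 1"; cases "i = 0") (auto simp: north_def)
  then show "x = north" by auto
qed (simp add: north_def)

lemma S2_le_1: "x \<in> S2 \<Longrightarrow> x 2 \<le> 1"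
proof -
  assume "x \<in> S2"
  then have "(x 2)\<^sup>2 \<le> 1" unfolding S2_iff by (metis add.commute le_add_same_cancel1 sum_power2_ge_zero)
  then show ?thesis by (rule power2_le_imp_le[of "x 2" 1, simplified])
qed

lemma unstereo_in_S2: "unstereo z \<in> S2"
proof -
  define N where "N = (norm z)\<^sup>2"
  have N: "N = (Re z)\<^sup>2 + (Im z)\<^sup>2" by (simp add: N_def cmod_power2)
  have "N + 1 > 0" unfolding N_def by (rule norm_sq_plus_1_pos)
  have "(2 * Im z)\<^sup>2 + (2 * Re z)\<^sup>2 + (N - 1)\<^sup>2 = (N + 1)\<^sup>2"
    by (simp add: power2_eq_square N algebra_simps)
  then have "(2 * Im z / (N + 1))\<^sup>2 + (2 * Re z / (N + 1))\<^sup>2 + ((N - 1) / (N + 1))\<^sup>2 = 1"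
    using \<open>N + 1 > 0\<close> by (simp add: power_divide flip: add_divide_distrib)
  then show ?thesis by (simp add: S2_iff unstereo_def N_def)
qed

lemma unstereo_neq_north: "unstereo z \<noteq> north"
  using norm_sq_plus_1_pos[of z] by (auto simp: S2_eq_north_iff[OF unstereo_in_S2] unstereo_def divide_simps)

lemma stereo_unstereo: "stereo (unstereo z) = z"
proof -
  define N where "N = (norm z)\<^sup>2"
  have "N + 1 > 0" unfolding N_def by (rule norm_sq_plus_1_pos)
  then have "1 - (N - 1) / (N + 1) = 2 / (N + 1)" by (simp add: field_simps)
  then show ?thesis using \<open>N + 1 > 0\<close>
    by (simp add: stereo_def unstereo_def complex_eq_iff flip: N_def)
qed

lemma norm_stereo_sq:
  assumes "x \<in> S2" "x \<noteq> north"
  shows "(norm (stereo x))\<^sup>2 = (1 + x 2) / (1 - x 2)"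
proof -
  have d: "1 - x 2 > 0" using S2_le_1[OF assms(1)] S2_eq_north_iff[OF assms(1)] assms(2) by force
  have "(norm (stereo x))\<^sup>2 = ((x 1)\<^sup>2 + (x 0)\<^sup>2) / (1 - x 2)\<^sup>2"
    by (simp add: cmod_power2 stereo_def power_divide add_divide_distrib)
  also have "(x 1)\<^sup>2 + (x 0)\<^sup>2 = (1 + x 2) * (1 - x 2)"
    using assms(1) by (simp add: S2_iff algebra_simps power2_eq_square)
  finally show ?thesis using d by (simp add: power2_eq_square)
qed

lemma unstereo_stereo:
  assumes "x \<in> S2" "x \<noteq> north"
  shows "unstereo (stereo x) = x"
proof
  fix i
  have d: "1 - x 2 > 0" using S2_le_1[OF assms(1)] S2_eq_north_iff[OF assms(1)] assms(2) by force
  have N: "(norm (stereo x))\<^sup>2 + 1 = 2 / (1 - x 2)" "(norm (stereo x))\<^sup>2 - 1 = 2 * x 2 / (1 - x 2)"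
    using d by (simp_all add: norm_stereo_sq[OF assms] field_simps)
  have "x i = 0" if "i > 2" using assms(1) that by (simp add: S2_iff)
  then show "unstereo (stereo x) i = x i"
    using d unfolding unstereo_def N by (auto simp: stereo_def)
qed

lemma continuous_on_unstereo: "continuous_on A unstereo"
proof (rule continuous_on_coordinatewise_then_product)
  fix i
  have "(norm z)\<^sup>2 + 1 \<noteq> 0" for z :: complex using norm_sq_plus_1_pos[of z] by simp
  then have "continuous_on A (\<lambda>z. 2 * Im z / ((norm z)\<^sup>2 + 1))" "continuous_on A (\<lambda>z. 2 * Re z / ((norm z)\<^sup>2 + 1))"
    "continuous_on A (\<lambda>z. ((norm z)\<^sup>2 - 1) / ((norm z)\<^sup>2 + 1))" by (intro continuous_intros; simp)+
  then show "continuous_on A (\<lambda>z. unstereo z i)"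
    unfolding unstereo_def by (cases "i = 0"; cases "i = 1"; cases "i = 2") simp_all
qed

lemma continuous_on_coordinate: "continuous_on A (\<lambda>x. x i :: real)"
  by (rule continuous_on_subset[OF continuous_on_product_coordinates]) simp

lemma continuous_on_stereo: "continuous_on (S2 - {north}) stereo"
proof -
  have "1 - x 2 \<noteq> 0" if "x \<in> S2 - {north}" for x using that S2_eq_north_iff by force
  then have "continuous_on (S2 - {north}) (\<lambda>x. of_real (x 1 / (1 - x 2)) + \<i> * of_real (x 0 / (1 - x 2)))"
    by (intro continuous_intros continuous_on_coordinate) auto
  then show ?thesis by (simp add: stereo_def[abs_def] Complex_eq)
qed

text \<open>
  A quantitative form of the convergence of \<open>unstereo z\<close> to the north pole as \<open>z\<close> tends to infinity.
\<close>

lemma unstereo_near_north: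
  assumes "z \<noteq> 0"
  shows "\<bar>unstereo z i - north i\<bar> \<le> 2 / norm z"
proof -
  define N where "N = (norm z)\<^sup>2 + 1"
  have N: "N > 0" unfolding N_def by (rule norm_sq_plus_1_pos)
  have z: "norm z > 0" using assms by simp
  have "norm z * norm z \<le> N" by (simp add: N_def power2_eq_square)
  then have 1: "2 * norm z / N \<le> 2 / norm z" using N z by (simp add: divide_simps)
  have "0 \<le> (norm z - 1)\<^sup>2" by simp
  also have "\<dots> = N - 2 * norm z" by (simp add: N_def power2_eq_square algebra_simps)
  finally have "norm z \<le> N" using z by linarith
  then have 2: "2 / N \<le> 2 / norm z" using mult_pos_pos[OF N z] by (intro divide_left_mono) auto
  have "\<bar>2 * Im z / N\<bar> \<le> 2 * norm z / N" "\<bar>2 * Re z / N\<bar> \<le> 2 * norm z / N"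
    using N abs_Im_le_cmod[of z] abs_Re_le_cmod[of z] by (simp_all add: divide_right_mono abs_mult)
  moreover have "((norm z)\<^sup>2 - 1) / N - 1 = - (2 / N)" using N by (simp add: N_def field_simps)
  then have "\<bar>((norm z)\<^sup>2 - 1) / N - 1\<bar> = 2 / N" using N by simp
  ultimately show ?thesis using 1 2 z by (auto simp: unstereo_def north_def simp flip: N_def)
qed

lemma stereo_large:
  assumes "x \<in> S2" "x \<noteq> north" "0 \<le> B" "x 2 > 1 - 1 / (B\<^sup>2 + 1)"
  shows "B < norm (stereo x)"
proof -
  have d: "1 - x 2 > 0" using S2_le_1[OF assms(1)] S2_eq_north_iff[OF assms(1)] assms(2) by force
  have B: "B\<^sup>2 + 1 > 0" by (simp add: add_nonneg_pos)
  have "1 / (B\<^sup>2 + 1) \<le> 1" using B by simp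
  then have "x 2 > 0" using assms(4) by simp
  have "(1 - x 2) * (B\<^sup>2 + 1) < 1" using assms(4) B by (simp add: field_simps)
  then have "B\<^sup>2 < 1 / (1 - x 2)" using d by (simp add: field_simps)
  also have "\<dots> \<le> (1 + x 2) / (1 - x 2)" using d \<open>x 2 > 0\<close> by (simp add: divide_simps)
  finally have "B\<^sup>2 < (norm (stereo x))\<^sup>2" using norm_stereo_sq[OF assms(1,2)] by simp
  then show ?thesis by (rule power2_less_imp_less) simp
qed

lemma continuous_on_open_and_points:
  assumes "open U" "continuous_on (T \<inter> U) h" "\<And>p. p \<in> T - U \<Longrightarrow> continuous (at p within T) h"
  shows "continuous_on T h"
  unfolding continuous_on_eq_continuous_within
proof
  fix p assume "p \<in> T"
  show "continuous (at p within T) h"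
  proof (cases "p \<in> U")
    case True
    then have "at p within T = at p within (T \<inter> U)"
      using assms(1) by (intro at_within_nhd[of p U]) auto
    then show ?thesis using assms(2) True \<open>p \<in> T\<close> by (simp add: continuous_on_eq_continuous_within)
  qed (use assms(3) \<open>p \<in> T\<close> in auto)
qed

text \<open>
  A map of the form \<open>a + (z - a) powi (- 1) * exp (L z)\<close> can also be written \<open>a + cnj (z - a) * exp (M z)\<close>.
  Scaling \<open>M\<close> down to \<open>0\<close>, while \<open>a\<close> moves to \<open>cnj a\<close>, deforms it to complex conjugation. During the
  deformation the distance from the moving centre stays between \<open>norm (z - a)\<close> and \<open>norm (F z - a)\<close>. Both
  tend to \<open>0\<close> at \<open>a\<close> and to infinity at infinity, so the deformation is continuous at the puncture \<open>a\<close> and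
  extends continuously to the north pole.
\<close>

lemma Brouwer_degree2_eq_minus_1:
  assumes contf: "continuous_on S2 f" and fS: "f ` S2 \<subseteq> S2"
    and north: "\<And>x. x \<in> S2 \<Longrightarrow> f x = north \<longleftrightarrow> x = north"
    and F: "\<And>z. F z = stereo (f (unstereo z))" and Fa: "F a = a"
    and w: "wraps (\<lambda>z. F z - a) a (- 1) (- {a})"
  shows "Brouwer_degree2 2 f = - 1"
proof -
  obtain L where L: "continuous_on (- {a}) L" "\<And>z. z \<noteq> a \<Longrightarrow> F z - a = (z - a) powi (- 1) * exp (L z)"
    using w unfolding wraps_def by auto
  (* 1 / (z - a) is cnj (z - a) divided by the square of its norm. *)
  define M where "M z = L z - of_real (2 * ln (norm (z - a)))" for z
  have contM: "continuous_on (- {a}) M" unfolding M_def by (intro continuous_intros L) auto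
  have FM: "F z - a = cnj (z - a) * exp (M z)" if "z \<noteq> a" for z
  proof -
    have n: "norm (z - a) > 0" using that by simp
    have "exp (2 * ln (norm (z - a))) = (norm (z - a))\<^sup>2"
      using n by (simp add: exp_double)
    then have "exp (M z) = exp (L z) / of_real ((norm (z - a))\<^sup>2)"
      unfolding M_def exp_diff by (metis exp_of_real)
    moreover have "of_real ((norm (z - a))\<^sup>2) = (z - a) * cnj (z - a)" by (rule complex_norm_square)
    moreover have "cnj (z - a) \<noteq> 0" using that by (simp del: complex_cnj_diff)
    ultimately have "cnj (z - a) * exp (M z) = inverse (z - a) * exp (L z)"
      by (simp add: divide_inverse del: complex_cnj_diff)
    then show ?thesis using L(2)[OF that] by (simp add: power_int_minus del: complex_cnj_diff)
  qed
  have Fz: "unstereo z \<in> S2 - {north}" "f (unstereo z) \<in> S2 - {north}" for z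
    using unstereo_in_S2[of z] unstereo_neq_north[of z] fS north by auto
  have contF: "continuous_on UNIV F"
    unfolding F using Fz
    by (intro continuous_on_compose2[OF continuous_on_stereo] continuous_on_compose2[OF contf] continuous_on_unstereo) auto
  define u where "u t = of_real (1 - t) * a + of_real t * cnj a" for t :: real
  define E where "E q = cnj (snd q - a) * exp (of_real (1 - fst q) * M (snd q))" for q :: "real \<times> complex"
  define H where "H q = u (fst q) + E q" for q
  have nu: "norm (u t) \<le> norm a" if "t \<in> {0..1}" for t
  proof -
    have "norm (u t) \<le> norm (of_real (1 - t) * a) + norm (of_real t * cnj a)" unfolding u_def by (rule norm_triangle_ineq)
    also have "\<dots> = (1 - t) * norm a + t * norm a"
      using that by (simp only: norm_mult norm_of_real complex_mod_cnj) simp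
    finally show ?thesis by (simp add: algebra_simps)
  qed
  have nE: "min (norm (z - a)) (norm (F z - a)) \<le> norm (E (t, z)) \<and> norm (E (t, z)) \<le> max (norm (z - a)) (norm (F z - a))"
    if t: "t \<in> {0..1}" for t z
  proof (cases "z = a")
    case True
    then show ?thesis by (simp add: E_def Fa)
  next
    case False
    have n: "norm (E (t, z)) = norm (z - a) * exp ((1 - t) * Re (M z))" "norm (F z - a) = norm (z - a) * exp (Re (M z))"
      unfolding E_def FM[OF False] by (simp_all add: norm_mult del: complex_cnj_diff)
    show ?thesis
    proof (cases "Re (M z) \<ge> 0")
      case True
      then have "0 \<le> (1 - t) * Re (M z)" "(1 - t) * Re (M z) \<le> Re (M z)"
        using t by (auto simp: mult_left_le_one_le)
      then have "norm (z - a) * 1 \<le> norm (E (t, z))" "norm (E (t, z)) \<le> norm (F z - a)"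
        unfolding n by (intro mult_left_mono; simp)+
      then show ?thesis by auto
    next
      case False
      then have "(1 - t) * Re (M z) \<le> 0" "t * Re (M z) \<le> 0"
        using t by (auto simp: mult_nonneg_nonpos)
      then have "norm (E (t, z)) \<le> norm (z - a) * 1" "norm (F z - a) \<le> norm (E (t, z))"
        unfolding n by (intro mult_left_mono; simp add: algebra_simps)+
      then show ?thesis by auto
    qed
  qed
  have contH: "continuous_on ({0..1} \<times> UNIV) H"
  proof (rule continuous_on_open_and_points[where U = "UNIV \<times> - {a}"])
    show "open (UNIV \<times> - {a} :: (real \<times> complex) set)" by (intro open_Times) auto
    have "continuous_on ({0..1} \<times> UNIV \<inter> UNIV \<times> - {a}) (\<lambda>q. M (snd q))"
      by (intro continuous_on_compose2[OF contM] continuous_intros) auto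
    then show "continuous_on ({0..1} \<times> UNIV \<inter> UNIV \<times> - {a}) H"
      unfolding H_def E_def u_def by (intro continuous_intros)
    fix q :: "real \<times> complex" assume q: "q \<in> {0..1} \<times> UNIV - UNIV \<times> - {a}"
    have cm: "continuous_on UNIV (\<lambda>q::real \<times> complex. max (norm (snd q - a)) (norm (F (snd q) - a)))"
      by (intro continuous_intros continuous_on_compose2[OF contF]) auto
    have "(E \<longlongrightarrow> 0) (at q within {0..1} \<times> UNIV)"
    proof (rule Lim_null_comparison)
      show "\<forall>\<^sub>F x in at q within {0..1} \<times> UNIV. norm (E x) \<le> max (norm (snd x - a)) (norm (F (snd x) - a))"
        unfolding eventually_at_filter using nE by (intro always_eventually) auto
      have "((\<lambda>q. max (norm (snd q - a)) (norm (F (snd q) - a))) \<longlongrightarrow> max (norm (snd q - a)) (norm (F (snd q) - a)))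
          (at q within {0..1} \<times> UNIV)"
        using continuous_on_subset[OF cm, of "{0..1} \<times> UNIV"] q unfolding continuous_on_def by blast
      moreover have "max (norm (snd q - a)) (norm (F (snd q) - a)) = 0" using q by (auto simp: Fa)
      ultimately show "((\<lambda>q. max (norm (snd q - a)) (norm (F (snd q) - a))) \<longlongrightarrow> 0) (at q within {0..1} \<times> UNIV)"
        by simp
    qed
    moreover have "((\<lambda>q::real \<times> complex. u (fst q)) \<longlongrightarrow> u (fst q)) (at q within {0..1} \<times> UNIV)"
      unfolding u_def by (intro tendsto_intros)
    ultimately have "(H \<longlongrightarrow> u (fst q) + 0) (at q within {0..1} \<times> UNIV)"
      unfolding H_def by (intro tendsto_add)
    then show "continuous (at q within {0..1} \<times> UNIV) H"
      using q by (auto simp: continuous_within H_def E_def)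
  qed
  define h where "h q = (if snd q = north then north else unstereo (H (fst q, stereo (snd q))))" for q :: "real \<times> (nat \<Rightarrow> real)"
  define T where "T = {0..1::real} \<times> S2"
  have "continuous_on T h"
  proof (rule continuous_on_coordinatewise_then_product)
    fix i
    show "continuous_on T (\<lambda>q. h q i)"
    proof (rule continuous_on_open_and_points[where U = "{q. snd q 2 \<noteq> 1}"])
      have "continuous_on UNIV (\<lambda>q::real \<times> (nat \<Rightarrow> real). snd q 2)"
        by (rule continuous_on_compose2[OF continuous_on_coordinate[of UNIV 2] continuous_on_snd]) (auto intro: continuous_intros)
      then show "open {q::real \<times> (nat \<Rightarrow> real). snd q 2 \<noteq> 1}" by (intro open_Collect_neq) auto
      have TU: "snd q \<in> S2 - {north}" "fst q \<in> {0..1}" if "q \<in> T \<inter> {q. snd q 2 \<noteq> 1}" for q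
        using that by (auto simp: T_def north_def)
      have "continuous_on (T \<inter> {q. snd q 2 \<noteq> 1}) (\<lambda>q. unstereo (H (fst q, stereo (snd q))))"
        using TU
        by (intro continuous_on_compose2[OF continuous_on_unstereo] continuous_on_compose2[OF contH]
            continuous_on_Pair continuous_on_compose2[OF continuous_on_stereo] continuous_on_fst continuous_on_snd continuous_on_id) auto
      then have "continuous_on (T \<inter> {q. snd q 2 \<noteq> 1}) (\<lambda>q. unstereo (H (fst q, stereo (snd q))) i)"
        by (rule continuous_on_product_then_coordinatewise)
      then show "continuous_on (T \<inter> {q. snd q 2 \<noteq> 1}) (\<lambda>q. h q i)"
        by (rule continuous_on_eq) (use TU in \<open>auto simp: h_def\<close>)
      fix q assume "q \<in> T - {q. snd q 2 \<noteq> 1}"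
      then obtain t where q: "q = (t, north)" "t \<in> {0..1}"
        using S2_eq_north_iff by (auto simp: T_def)
      have qT: "q \<in> T" using q north_in_S2 by (simp add: T_def)
      have "((\<lambda>q. h q i) \<longlongrightarrow> north i) (at q within T)"
      proof (rule tendstoI)
        fix e :: real assume e: "0 < e"
        (* If z and F z both exceed B in norm, then the deformed point exceeds 2 / e: the
           centre a is subtracted once and the moving centre, which has norm at most norm a, once. *)
        define B where "B = 2 / e + 2 * norm a"
        define d where "d = 1 - 1 / (B\<^sup>2 + 1)"
        have "0 \<le> B" using e by (simp add: B_def)
        have "d < 1" by (simp add: d_def add_nonneg_pos)
        have c1: "continuous_on T (\<lambda>q. snd q 2)"
          by (rule continuous_on_compose2[OF continuous_on_coordinate[of UNIV 2] continuous_on_snd]) (auto intro: continuous_intros)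
        have c2: "continuous_on T (\<lambda>q. f (snd q) 2)"
          by (intro continuous_on_compose2[OF continuous_on_product_then_coordinatewise[OF contf]] continuous_on_snd continuous_on_id)
            (auto simp: T_def)
        have l1: "((\<lambda>q. snd q 2) \<longlongrightarrow> 1) (at q within T)"
          using c1 qT q(1) by (force simp: continuous_on_def north_def)
        have "f north = north" using north north_in_S2 by blast
        then have l2: "((\<lambda>q. f (snd q) 2) \<longlongrightarrow> 1) (at q within T)"
          using c2 qT q(1) by (force simp: continuous_on_def north_def)
        have "\<forall>\<^sub>F q in at q within T. q \<in> T" by (simp add: eventually_at_filter)
        then show "\<forall>\<^sub>F q in at q within T. dist (h q i) (north i) < e"
          using order_tendstoD(1)[OF l1 \<open>d < 1\<close>] order_tendstoD(1)[OF l2 \<open>d < 1\<close>]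
        proof eventually_elim
          case (elim q)
          define t where "t = fst q"
          define x where "x = snd q"
          have tx: "t \<in> {0..1}" "x \<in> S2" using elim by (auto simp: T_def t_def x_def)
          show ?case
          proof (cases "x = north")
            case True
            then show ?thesis using e by (simp add: h_def x_def)
          next
            case False
            define z where "z = stereo x"
            have "B < norm z" unfolding z_def
              using stereo_large[OF tx(2) False \<open>0 \<le> B\<close>] elim by (simp add: d_def x_def)
            have "F z = stereo (f x)" by (simp add: F z_def unstereo_stereo[OF tx(2) False])
            moreover have "f x \<in> S2" "f x \<noteq> north" using fS tx(2) north[OF tx(2)] False by auto
            ultimately have "B < norm (F z)"
              using stereo_large[of "f x" B] \<open>0 \<le> B\<close> elim by (simp add: d_def x_def)
            then have "B - norm a < norm (F z - a)" using norm_triangle_ineq2[of "F z" a] by linarith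
            moreover have "B - norm a < norm (z - a)" using \<open>B < norm z\<close> norm_triangle_ineq2[of z a] by linarith
            ultimately have "B - norm a < norm (E (t, z))" using nE[OF tx(1), of z] by linarith
            moreover have "norm (E (t, z)) \<le> norm (H (t, z)) + norm (u t)"
              using norm_triangle_ineq4[of "H (t, z)" "u t"] by (simp add: H_def)
            ultimately have "2 / e < norm (H (t, z))" using nu[OF tx(1)] by (simp add: B_def)
            moreover have "0 < 2 / e" using e by simp
            ultimately have "0 < norm (H (t, z))" "2 < norm (H (t, z)) * e"
              using e by (linarith, simp add: pos_divide_less_eq)
            then have "H (t, z) \<noteq> 0" "2 / norm (H (t, z)) < e" by (auto simp: pos_divide_less_eq mult.commute)
            then have "\<bar>unstereo (H (t, z)) i - north i\<bar> < e" using unstereo_near_north[of "H (t, z)" i] by linarith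
            then show ?thesis using False by (simp add: h_def t_def x_def z_def dist_real_def)
          qed
        qed
      qed
      then show "continuous (at q within T) (\<lambda>q. h q i)" using q by (simp add: continuous_within h_def)
    qed
  qed
  moreover have "h ` T \<subseteq> S2" using unstereo_in_S2 north_in_S2 by (auto simp: h_def)
  moreover have "h (0, x) = f x" if "x \<in> S2" for x
  proof (cases "x = north")
    case False
    define z where "z = stereo x"
    have "f x \<in> S2" "f x \<noteq> north" using fS that north[OF that] False by auto
    moreover have "H (0, z) = F z"
    proof (cases "z = a")
      case False
      have "F z = a + cnj (z - a) * exp (M z)" using FM[OF False] by (metis add.commute diff_add_cancel)
      then show ?thesis by (simp add: H_def u_def E_def)
    qed (simp add: H_def u_def E_def Fa)
    moreover have "F z = stereo (f x)" by (simp add: F z_def unstereo_stereo[OF that False])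
    ultimately show ?thesis using False by (simp add: h_def unstereo_stereo z_def[symmetric])
  next
    case True
    have "f north = north" using north north_in_S2 by blast
    then show ?thesis using True by (simp add: h_def)
  qed
  moreover have "h (1, x) = (\<lambda>i. if i = 0 then - x i else x i)" if x: "x \<in> S2" for x
  proof (cases "x = north")
    case False
    have "H (1, z) = cnj z" for z by (simp add: H_def u_def E_def)
    then have "h (1, x) = unstereo (cnj (stereo x))" using False by (simp add: h_def)
    also have "\<dots> = (\<lambda>i. if i = 0 then - unstereo (stereo x) i else unstereo (stereo x) i)"
      by (auto simp: unstereo_def)
    finally show ?thesis unfolding unstereo_stereo[OF x False] .
  qed (auto simp: h_def north_def)
  ultimately have "homotopic_with (\<lambda>x. True) (nsphere 2) (nsphere 2) f (\<lambda>x i. if i = 0 then - x i else x i)"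
    unfolding nsphere_2 T_def by (subst homotopic_with) (auto intro!: exI[of _ h])
  from Brouwer_degree2_homotopic[OF this] show ?thesis by (simp add: Brouwer_degree2_reflection)
qed

section \<open>Periodic sphere homeomorphisms with three fixed points\<close>

text \<open>
  In the stereographic chart a fixed point has exponent \<open>1\<close> or \<open>-1\<close>; exponent \<open>-1\<close> would give degree \<open>-1\<close>.
\<close>

lemma periodic_fixing_north_and_two_points_trivial:
  assumes f: "homeomorphic_map (nsphere 2) (nsphere 2) f" and deg: "Brouwer_degree2 2 f = 1"
    and n: "0 < n" "\<And>x. x \<in> S2 \<Longrightarrow> (f ^^ n) x = x"
    and fnorth: "f north = north"
    and b: "b \<in> S2" "b \<noteq> north" "f b = b" and c: "c \<in> S2" "c \<noteq> north" "f c = c" and "b \<noteq> c"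
    and x: "x \<in> S2"
  shows "f x = x"
proof (cases "x = north")
  case False
  obtain g where "homeomorphic_maps (nsphere 2) (nsphere 2) f g"
    using f by (auto simp: homeomorphic_map_maps)
  then have contf: "continuous_on S2 f" and contg: "continuous_on S2 g" and fS: "f ` S2 \<subseteq> S2" and gS: "g ` S2 \<subseteq> S2"
    and gf: "\<And>x. x \<in> S2 \<Longrightarrow> g (f x) = x" and fg: "\<And>x. x \<in> S2 \<Longrightarrow> f (g x) = x"
    by (auto simp: homeomorphic_maps_def nsphere_2 continuous_map_in_subtopology)
  have gnorth: "g north = north" using gf[OF north_in_S2] fnorth by simp
  have fno: "f x = north \<longleftrightarrow> x = north" and gno: "g x = north \<longleftrightarrow> x = north" if "x \<in> S2" for x
    using gf[OF that] fg[OF that] fnorth gnorth by metis+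
  define F where "F z = stereo (f (unstereo z))" for z
  define G where "G z = stereo (g (unstereo z))" for z
  have fz: "f (unstereo z) \<in> S2" "f (unstereo z) \<noteq> north" and gz: "g (unstereo z) \<in> S2" "g (unstereo z) \<noteq> north" for z
    using unstereo_in_S2[of z] unstereo_neq_north[of z] fS gS fno gno by auto
  have contF: "continuous_on UNIV F"
    unfolding F_def using fz unstereo_in_S2
    by (intro continuous_on_compose2[OF continuous_on_stereo] continuous_on_compose2[OF contf] continuous_on_unstereo) auto
  have contG: "continuous_on UNIV G"
    unfolding G_def using gz unstereo_in_S2
    by (intro continuous_on_compose2[OF continuous_on_stereo] continuous_on_compose2[OF contg] continuous_on_unstereo) auto
  have GF: "G (F z) = z" and FG: "F (G z) = z" for z
    by (simp_all add: F_def G_def unstereo_stereo[OF fz] unstereo_stereo[OF gz] gf fg unstereo_in_S2 stereo_unstereo)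
  have itS: "(f ^^ k) (unstereo z) \<in> S2 \<and> (f ^^ k) (unstereo z) \<noteq> north" for k z
    by (induction k) (use unstereo_in_S2 unstereo_neq_north fS fno in auto)
  have itF: "(F ^^ k) z = stereo ((f ^^ k) (unstereo z))" for k z
  proof (induction k)
    case (Suc k)
    then show ?case using itS[of k z] by (simp add: F_def unstereo_stereo)
  qed (simp add: stereo_unstereo)
  define a where "a = stereo b"
  have Fa: "F a = a" and Fc: "F (stereo c) = stereo c"
    using b c by (simp_all add: F_def a_def unstereo_stereo)
  have "stereo c \<noteq> a" using unstereo_stereo[OF b(1,2)] unstereo_stereo[OF c(1,2)] \<open>b \<noteq> c\<close> by (metis a_def)
  have "wraps (\<lambda>z. F z - a) a 1 (- {a})"
    using homeomorphism_wraps[OF contF contG GF FG Fa]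
      Brouwer_degree2_eq_minus_1[OF contf fS fno F_def Fa] deg by auto
  moreover have "(F ^^ n) z = z" for z by (simp add: itF n(2) unstereo_in_S2 stereo_unstereo)
  ultimately have "F (stereo x) = stereo x"
    using periodic_fixing_two_points_trivial_translated[OF _ contF Fa \<open>stereo c \<noteq> a\<close> Fc n(1)] by blast
  then have "stereo (f x) = stereo x" by (simp add: F_def unstereo_stereo[OF x False])
  moreover have "f x \<in> S2" "f x \<noteq> north" using fS x fno[OF x] False by auto
  ultimately show ?thesis using unstereo_stereo[of "f x"] unstereo_stereo[OF x False] by metis
qed (simp add: fnorth)

definition dot3 :: "(nat \<Rightarrow> real) \<Rightarrow> (nat \<Rightarrow> real) \<Rightarrow> real" where
  "dot3 x y = x 0 * y 0 + x 1 * y 1 + x 2 * y 2"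

definition householder :: "(nat \<Rightarrow> real) \<Rightarrow> (nat \<Rightarrow> real) \<Rightarrow> nat \<Rightarrow> real" where
  "householder v x i = x i - 2 * dot3 x v / dot3 v v * v i"

lemma dot3_householder:
  assumes "dot3 v v \<noteq> 0"
  shows "dot3 (householder v x) v = - dot3 x v" "dot3 (householder v x) (householder v x) = dot3 x x"
proof -
  define k where "k = 2 * dot3 x v / dot3 v v"
  have k: "k * dot3 v v = 2 * dot3 x v" using assms by (simp add: k_def)
  have h: "householder v x i = x i - k * v i" for i by (simp add: householder_def k_def)
  have "dot3 (householder v x) v = dot3 x v - k * dot3 v v"
    by (simp add: dot3_def h algebra_simps)
  then show "dot3 (householder v x) v = - dot3 x v" by (simp add: k)
  have "dot3 (householder v x) (householder v x) = dot3 x x - 2 * k * dot3 x v + k * (k * dot3 v v)"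
    by (simp add: dot3_def h algebra_simps)
  then show "dot3 (householder v x) (householder v x) = dot3 x x" by (simp add: k)
qed

text \<open>
  The Householder reflection in the direction \<open>c - north\<close> exchanges \<open>c\<close> and \<open>north\<close>.
\<close>

lemma exists_involution_to_north:
  assumes c: "c \<in> S2"
  obtains h where "continuous_map (nsphere 2) (nsphere 2) h" "\<And>x. x \<in> S2 \<Longrightarrow> h (h x) = x" "h c = north"
proof (cases "c = north")
  case True
  then show thesis by (intro that[of id]) auto
next
  case False
  define v where "v i = c i - north i" for i
  have S2_dot: "x \<in> S2 \<longleftrightarrow> dot3 x x = 1 \<and> (\<forall>i>2. x i = 0)" for x
    by (simp add: S2_iff dot3_def power2_eq_square)
  have c1: "dot3 c c = 1" using c by (simp add: S2_dot)
  have vv: "dot3 v v = 2 - 2 * c 2"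
    using c1 by (simp add: dot3_def v_def north_def algebra_simps)
  have "c 2 \<noteq> 1" using S2_eq_north_iff[OF c] False by simp
  then have nz: "dot3 v v \<noteq> 0" by (simp add: vv)
  have cv: "2 * dot3 c v = dot3 v v"
    using c1 unfolding vv by (simp add: dot3_def v_def north_def algebra_simps)
  show thesis
  proof (rule that)
    have "householder v ` S2 \<subseteq> S2"
    proof
      fix y assume "y \<in> householder v ` S2"
      then obtain x where x: "x \<in> S2" "y = householder v x" by auto
      have "y i = 0" if "i > 2" for i
        using x c that by (simp add: householder_def v_def north_def S2_dot)
      then show "y \<in> S2" using x dot3_householder(2)[OF nz, of x] by (simp add: S2_dot)
    qed
    moreover have "continuous_on S2 (householder v)"
    proof (rule continuous_on_coordinatewise_then_product)
      fix i
      show "continuous_on S2 (\<lambda>x. householder v x i)"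
        unfolding householder_def dot3_def[of _ v]
        by (intro continuous_intros continuous_on_coordinate) (use nz in \<open>simp add: dot3_def\<close>)
    qed
    ultimately show "continuous_map (nsphere 2) (nsphere 2) (householder v)"
      by (auto simp: nsphere_2 continuous_map_in_subtopology)
    show "householder v (householder v x) = x" for x
    proof
      fix i
      show "householder v (householder v x) i = x i"
        unfolding householder_def[of v "householder v x"] dot3_householder(1)[OF nz] by (simp add: householder_def)
    qed
    show "householder v c = north"
      using nz by (auto simp: householder_def cv v_def fun_eq_iff)
  qed
qed

text \<open>
  Conjugation by an involution that moves one fixed point to the north pole preserves the degree,
  because the degree of an involution squares to \<open>1\<close>.
\<close>

theorem periodic_fixing_three_points_trivial:
  assumes f: "homeomorphic_map (nsphere 2) (nsphere 2) f" and deg: "Brouwer_degree2 2 f = 1"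
    and n: "0 < n" "\<And>x. x \<in> S2 \<Longrightarrow> (f ^^ n) x = x"
    and abc: "a \<in> S2" "b \<in> S2" "c \<in> S2" "a \<noteq> b" "a \<noteq> c" "b \<noteq> c"
    and fix_abc: "f a = a" "f b = b" "f c = c"
    and x: "x \<in> S2"
  shows "f x = x"
proof -
  obtain h where h: "continuous_map (nsphere 2) (nsphere 2) h" "\<And>x. x \<in> S2 \<Longrightarrow> h (h x) = x" "h c = north"
    using exists_involution_to_north[OF abc(3)] by metis
  have hS: "h x \<in> S2" if "x \<in> S2" for x
    using h(1) that by (auto simp: nsphere_2 continuous_map_in_subtopology)
  have hinj: "h x = h y \<longleftrightarrow> x = y" if "x \<in> S2" "y \<in> S2" for x y using h(2) that by metis
  have hh: "homeomorphic_map (nsphere 2) (nsphere 2) h"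
    unfolding homeomorphic_map_maps homeomorphic_maps_def using h(1,2) by (auto simp: nsphere_2)
  define k where "k = h \<circ> f \<circ> h"
  have fS: "f x \<in> S2" if "x \<in> S2" for x
    using homeomorphic_imp_continuous_map[OF f] that by (auto simp: nsphere_2 continuous_map_in_subtopology)
  have it: "(k ^^ j) (h x) = h ((f ^^ j) x) \<and> (f ^^ j) x \<in> S2" if "x \<in> S2" for j x
    by (induction j) (use that fS h(2) in \<open>auto simp: k_def\<close>)
  have "homeomorphic_map (nsphere 2) (nsphere 2) k"
    unfolding k_def by (rule homeomorphic_map_compose[OF hh homeomorphic_map_compose[OF f hh]])
  moreover have "Brouwer_degree2 2 k = 1"
  proof -
    have "Brouwer_degree2 2 h * Brouwer_degree2 2 h = Brouwer_degree2 2 (h \<circ> h)"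
      using Brouwer_degree2_compose[OF h(1) h(1)] by simp
    also have "\<dots> = Brouwer_degree2 2 id"
      by (rule Brouwer_degree2_eq) (simp add: nsphere_2 h(2))
    finally have "Brouwer_degree2 2 h * Brouwer_degree2 2 h = 1" by simp
    then show ?thesis unfolding k_def
      using homeomorphic_imp_continuous_map[OF f] h(1) deg
      by (simp add: Brouwer_degree2_compose continuous_map_compose)
  qed
  moreover have "(k ^^ n) x = x" if "x \<in> S2" for x
    using it[OF hS[OF that], of n] n(2)[OF hS[OF that]] h(2)[OF that] by simp
  moreover have "k north = north" "k (h a) = h a" "k (h b) = h b"
    using fix_abc abc h(2) unfolding h(3)[symmetric] by (simp_all add: k_def)
  moreover have "h a \<in> S2" "h a \<noteq> north" "h b \<in> S2" "h b \<noteq> north" "h a \<noteq> h b"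
    using abc hS hinj unfolding h(3)[symmetric] by simp_all
  ultimately have "k (h x) = h x"
    using periodic_fixing_north_and_two_points_trivial[of k n "h a" "h b" "h x"] n(1) hS[OF x] by blast
  then show ?thesis using hinj fS x h(2) by (simp add: k_def)
qed

section \<open>Groups with a finite orbit\<close>

theorem corollary2:
  fixes G :: "((nat \<Rightarrow> real) \<Rightarrow> (nat \<Rightarrow> real)) set"
  assumes "subgroup G (Homeo (nsphere 2))"
    and "\<forall>g\<in>G. orientation_preserving_homeo 2 g"
    and "finitely_generated_group (Homeo (nsphere 2)\<lparr>carrier := G\<rparr>)"
    and "periodic_group (Homeo (nsphere 2)\<lparr>carrier := G\<rparr>)"
    and "\<exists>x\<in>topspace (nsphere 2).
           finite (orbit (Homeo (nsphere 2)\<lparr>carrier := G\<rparr>) (\<lambda>g. g) x) \<and>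
           card (orbit (Homeo (nsphere 2)\<lparr>carrier := G\<rparr>) (\<lambda>g. g) x) \<ge> 3"
  shows "finite G"
proof -
  let ?H = "Homeo (nsphere 2)\<lparr>carrier := G\<rparr>"
  interpret H: group ?H using assms(4) by (simp add: periodic_group_def)
  have GB: "g \<in> Bij S2" if "g \<in> G" for g
    using subgroup.subset[OF assms(1)] that by (auto simp: Homeo_def nsphere_2)
  have mult: "g \<otimes>\<^bsub>?H\<^esub> h = compose S2 g h" if "g \<in> G" "h \<in> G" for g h
    using GB that by (simp add: Homeo_def BijGroup_def nsphere_2)
  have one: "\<one>\<^bsub>?H\<^esub> = (\<lambda>x\<in>S2. x)" by (simp add: Homeo_def BijGroup_def nsphere_2)
  have GS: "g x \<in> S2" if "g \<in> G" "x \<in> S2" for g x using GB[OF that(1)] that(2) by (auto simp: Bij_def bij_betw_def)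
  have pow: "(g [^]\<^bsub>?H\<^esub> (n::nat)) x = (g ^^ n) x" if g: "g \<in> G" and x: "x \<in> S2" for g x n
    using x
  proof (induction n arbitrary: x)
    case 0
    then show ?case by (simp add: one)
  next
    case (Suc n)
    have "g [^]\<^bsub>?H\<^esub> n \<in> G" using H.nat_pow_closed[of g n] g by simp
    then have "(g [^]\<^bsub>?H\<^esub> Suc n) x = (g [^]\<^bsub>?H\<^esub> n) (g x)"
      using mult g Suc.prems by (simp add: compose_def)
    then show ?case using Suc.IH GS[OF g Suc.prems] by (simp add: funpow_Suc_right del: funpow.simps)
  qed
  obtain o\<^sub>0 where o: "o\<^sub>0 \<in> S2" and fin: "finite (orbit ?H (\<lambda>g. g) o\<^sub>0)" and card: "3 \<le> card (orbit ?H (\<lambda>g. g) o\<^sub>0)"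
    using assms(5) by (auto simp: nsphere_2)
  define Orb where "Orb = orbit ?H (\<lambda>g. g) o\<^sub>0"
  have Orb: "Orb = {g o\<^sub>0 | g. g \<in> G}" by (simp add: Orb_def orbit_def)
  have OS: "Orb \<subseteq> S2" using GS o by (auto simp: Orb)
  have stable: "g y \<in> Orb" if g: "g \<in> G" and y: "y \<in> Orb" for g y
  proof -
    obtain k where k: "k \<in> G" "y = k o\<^sub>0" using y by (auto simp: Orb)
    then have "g y = (g \<otimes>\<^bsub>?H\<^esub> k) o\<^sub>0" using mult g o by (simp add: compose_def)
    moreover have "g \<otimes>\<^bsub>?H\<^esub> k \<in> G" using H.m_closed[of g k] g k by simp
    ultimately show ?thesis by (auto simp: Orb)
  qed
  obtain T where "T \<subseteq> Orb" "card T = 3" using card obtain_subset_with_card_n[of 3 Orb] by (auto simp: Orb_def)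
  then obtain a b c where abc: "{a, b, c} \<subseteq> Orb" "a \<noteq> b" "a \<noteq> c" "b \<noteq> c" by (auto simp: card_3_iff)
  have triv: "k x = x" if k: "k \<in> G" "\<And>y. y \<in> Orb \<Longrightarrow> k y = y" and x: "x \<in> S2" for k x
  proof -
    obtain n :: nat where n: "0 < n" "k [^]\<^bsub>?H\<^esub> n = \<one>\<^bsub>?H\<^esub>"
      using assms(4) k(1) by (auto simp: periodic_group_def)
    have "(k ^^ n) y = y" if "y \<in> S2" for y using pow[OF k(1) that, of n] n that by (simp add: one)
    moreover have "homeomorphic_map (nsphere 2) (nsphere 2) k" "Brouwer_degree2 2 k = 1"
      using assms(2) k(1) by (auto simp: orientation_preserving_homeo_def)
    ultimately show ?thesis
      using periodic_fixing_three_points_trivial[of k n a b c x] n(1) abc OS k(2) x by auto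
  qed
  have "inj_on (\<lambda>g. restrict g Orb) G"
  proof (rule inj_onI)
    fix g h assume gh: "g \<in> G" "h \<in> G" and eq: "restrict g Orb = restrict h Orb"
    define k where "k = inv\<^bsub>?H\<^esub> h \<otimes>\<^bsub>?H\<^esub> g"
    have ih: "inv\<^bsub>?H\<^esub> h \<in> G" using H.inv_closed[of h] gh by simp
    have kG: "k \<in> G" using H.m_closed[of "inv\<^bsub>?H\<^esub> h" g] ih gh by (simp add: k_def)
    have "compose S2 (inv\<^bsub>?H\<^esub> h) h = (\<lambda>x\<in>S2. x)"
      using H.l_inv[of h] gh mult[OF ih gh(2)] one by simp
    then have inv: "(inv\<^bsub>?H\<^esub> h) (h y) = y" if "y \<in> S2" for y
      using that by (metis compose_eq restrict_apply')
    have "k y = y" if y: "y \<in> Orb" for y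
    proof -
      have "g y = h y" using eq y by (metis restrict_apply')
      then show ?thesis using OS y inv mult[OF ih gh(1)] by (auto simp: k_def compose_def)
    qed
    then have "k = \<one>\<^bsub>?H\<^esub>"
      using GB[OF kG] unfolding one
      by (intro extensionalityI[of _ S2]) (auto simp: Bij_def triv[OF kG])
    then have "inv\<^bsub>?H\<^esub> g = inv\<^bsub>?H\<^esub> h"
      using gh ih by (intro H.inv_equality) (simp_all add: k_def)
    then have "inv\<^bsub>?H\<^esub> (inv\<^bsub>?H\<^esub> g) = inv\<^bsub>?H\<^esub> (inv\<^bsub>?H\<^esub> h)" by (rule arg_cong)
    then show "g = h" using H.inv_inv[of g] H.inv_inv[of h] gh by simp
  qed
  moreover have "(\<lambda>g. restrict g Orb) ` G \<subseteq> (\<Pi>\<^sub>E y\<in>Orb. Orb)" using stable by auto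
  moreover have "finite (\<Pi>\<^sub>E y\<in>Orb. Orb)" using fin by (intro finite_PiE) (auto simp: Orb_def)
  ultimately show ?thesis using finite_subset finite_imageD by metis
qed

end
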